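(* Let $\Omega$ be a set with exactly three elements, $m\in\Delta(\Omega)$, $\lambda\in[0,1)$, and consider the irreducible Markov chain on $\Omega$ with transitions $\pi(\omega\mid\omega)=(1-\lambda)m(\omega)+\lambda$ and $\pi(\omega'\mid\omega)=(1-\lambda)m(\omega')$ for $\omega'\ne\omega$ (so $\phi(p)=m+\lambda(p-m)$). Let $r:\Omega\to\mathbb{R}$ and $\delta\in[0,1)$. Then the greedy strategy $\sigma_*$ is optimal at every initial belief $p_1\in\Delta(\Omega)$ in each of the following cases: (i) $|\Omega^-|=1$; (ii) $|\Omega^-|=2$, writing $\Omega^+=\{A\}$ and $\Omega^-=\{B,C\}$ with $r(B)\ge r(C)$, and letting $B^+$ (resp. $C^+$) be the unique point of $\mathcal{F}$ on the segment $[A,B]$ (resp. $[A,C]$), the invariant distribution $m$ belongs either to $I$ or to the triangle with vertices $C^+,B^+,C$.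
   Context: Identify each $\omega\in\Omega$ with a unit vector of $\mathbb{R}^\Omega$ and $\Delta(\Omega)$ with the unit simplex. For $p\in\Delta(\Omega)$ let $\langle p,r\rangle=\sum_\omega p(\omega)r(\omega)$; $I=\{p:\langle p,r\rangle\ge0\}$, $J=\Delta(\Omega)\setminus I$, $\mathcal{F}=\{p:\langle p,r\rangle=0\}$; $\Omega^+=\{\omega:r(\omega)\ge0\}$, $\Omega^-=\{\omega:r(\omega)<0\}$. $\phi(q)=qM$ with $M$ the transition matrix. $\mathcal{S}(p)$ is the set of Borel probability measures on $\Delta(\Omega)$ with mean $p$, $\mu_p$ the Dirac mass at $p$. Decision problem from $p_1$: at each stage $n$, at belief $p_n$, the advisor chooses $\mu\in\mathcal{S}(p_n)$ (possibly depending on the past), a posterior $q_n\sim\mu$ is drawn, the stage payoff is $\mathbf{1}_{\{q_n\in I\}}$, and $p_{n+1}=\phi(q_n)$. A strategy's payoff is $\mathbb{E}[(1-\delta)\sum_{n\ge1}\delta^{n-1}\mathbf{1}_{\{q_n\in I\}}]$; $V_\delta(p_1)$ is the maximal payoff; a strategy is optimal at $p_1$ if it achieves $V_\delta(p_1)$. The greedy strategy $\sigma_*$: at $p\in I$ choose $\mu_p$; at $p\in J$ choose a two-point splitting $p=a_Iq_I+a_Jq_J$ (posterior $q_I$ w.p. $a_I$, $q_J$ w.p. $a_J$) maximizing $a_I$ subject to $q_I\in I$, $q_J\in\Delta(\Omega)$, $a_I+a_J=1$, $a_I,a_J\ge0$. *)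

theory Defs
  imports "HOL-Probability.Probability"
begin

text \<open>States: a finite type 'w. Beliefs: vectors in real^'w; state w is the unit vector axis w 1.\<close>

definition Delta :: "(real^'w::finite) set" where
  "Delta = {p. (\<forall>i. 0 \<le> p $ i) \<and> (\<Sum>i\<in>UNIV. p $ i) = 1}"

definition rpay :: "('w::finite \<Rightarrow> real) \<Rightarrow> real^'w \<Rightarrow> real" where
  "rpay r p = (\<Sum>w\<in>UNIV. p $ w * r w)"

definition Iset :: "('w::finite \<Rightarrow> real) \<Rightarrow> (real^'w) set" where
  "Iset r = {p \<in> Delta. rpay r p \<ge> 0}"

definition Jset :: "('w::finite \<Rightarrow> real) \<Rightarrow> (real^'w) set" where
  "Jset r = Delta - Iset r"

definition Fset :: "('w::finite \<Rightarrow> real) \<Rightarrow> (real^'w) set" where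
  "Fset r = {p \<in> Delta. rpay r p = 0}"

definition Omega_plus :: "('w::finite \<Rightarrow> real) \<Rightarrow> 'w set" where
  "Omega_plus r = {w. r w \<ge> 0}"

definition Omega_minus :: "('w::finite \<Rightarrow> real) \<Rightarrow> 'w set" where
  "Omega_minus r = {w. r w < 0}"

text \<open>Transition matrix: row w, column w' is pi(w' | w).\<close>
definition trans_matrix :: "real^'w \<Rightarrow> real \<Rightarrow> real^'w^'w::finite" where
  "trans_matrix m lam = (\<chi> i j. (1 - lam) * m $ j + (if i = j then lam else 0))"

definition mat_pow :: "real^'w^'w::finite \<Rightarrow> nat \<Rightarrow> real^'w^'w" where
  "mat_pow M n = ((\<lambda>A. A ** M) ^^ n) (mat 1)"

definition irreducible_chain :: "real^'w^'w::finite \<Rightarrow> bool" where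
  "irreducible_chain M \<longleftrightarrow> (\<forall>i j. \<exists>n. mat_pow M n $ i $ j > 0)"

definition phi :: "real^'w^'w::finite \<Rightarrow> real^'w \<Rightarrow> real^'w" where
  "phi M q = q v* M"

definition Splits :: "(real^'w::finite) \<Rightarrow> (real^'w) measure set" where
  "Splits p = {\<mu>. prob_space \<mu> \<and> sets \<mu> = sets borel \<and> emeasure \<mu> Delta = 1
                  \<and> has_bochner_integral \<mu> (\<lambda>q. q) p}"

text \<open>A (behaviour) strategy: at stage n (0-based) given the history h of past posteriors
  h 0, ..., h (n-1) (later entries irrelevant), it picks a measure. Current belief:\<close>
definition cur_belief :: "real^'w^'w::finite \<Rightarrow> real^'w \<Rightarrow> nat \<Rightarrow> (nat \<Rightarrow> real^'w) \<Rightarrow> real^'w" where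
  "cur_belief M p1 n h = (if n = 0 then p1 else phi M (h (n - 1)))"

definition is_strategy :: "real^'w^'w::finite \<Rightarrow> real^'w
    \<Rightarrow> (nat \<Rightarrow> (nat \<Rightarrow> real^'w) \<Rightarrow> (real^'w) measure) \<Rightarrow> bool" where
  "is_strategy M p1 \<sigma> \<longleftrightarrow>
     (\<forall>n. \<sigma> n \<in> measurable (PiM UNIV (\<lambda>_::nat. borel)) (subprob_algebra borel)
        \<and> (\<forall>h. (\<forall>i<n. h i \<in> Delta) \<longrightarrow> \<sigma> n h \<in> Splits (cur_belief M p1 n h)))"

primrec Wpay :: "('w::finite \<Rightarrow> real) \<Rightarrow> real
    \<Rightarrow> (nat \<Rightarrow> (nat \<Rightarrow> real^'w) \<Rightarrow> (real^'w) measure) \<Rightarrow> nat \<Rightarrow> nat \<Rightarrow> (nat \<Rightarrow> real^'w) \<Rightarrow> ennreal" where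
  "Wpay r \<delta> \<sigma> 0 n h = 0"
| "Wpay r \<delta> \<sigma> (Suc N) n h =
     (\<integral>\<^sup>+ q. ennreal ((1 - \<delta>) * indicator (Iset r) q) + ennreal \<delta> * Wpay r \<delta> \<sigma> N (Suc n) (h(n := q)) \<partial>(\<sigma> n h))"

text \<open>Payoff E[(1-delta) sum delta^(n-1) 1{q_n in I}] as the limit of the finite horizons.\<close>
definition payoff :: "('w::finite \<Rightarrow> real) \<Rightarrow> real
    \<Rightarrow> (nat \<Rightarrow> (nat \<Rightarrow> real^'w) \<Rightarrow> (real^'w) measure) \<Rightarrow> ennreal" where
  "payoff r \<delta> \<sigma> = (SUP N. Wpay r \<delta> \<sigma> N 0 (\<lambda>_. 0))"

definition value_fn :: "('w::finite \<Rightarrow> real) \<Rightarrow> real \<Rightarrow> real^'w^'w \<Rightarrow> real^'w \<Rightarrow> ennreal" where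
  "value_fn r \<delta> M p1 = (SUP \<sigma> \<in> {\<sigma>. is_strategy M p1 \<sigma>}. payoff r \<delta> \<sigma>)"

definition optimal :: "('w::finite \<Rightarrow> real) \<Rightarrow> real \<Rightarrow> real^'w^'w \<Rightarrow> real^'w
    \<Rightarrow> (nat \<Rightarrow> (nat \<Rightarrow> real^'w) \<Rightarrow> (real^'w) measure) \<Rightarrow> bool" where
  "optimal r \<delta> M p1 \<sigma> \<longleftrightarrow> is_strategy M p1 \<sigma> \<and> payoff r \<delta> \<sigma> = value_fn r \<delta> M p1"

definition feasible_split :: "('w::finite \<Rightarrow> real) \<Rightarrow> real^'w \<Rightarrow> real \<Rightarrow> real^'w \<Rightarrow> real^'w \<Rightarrow> bool" where
  "feasible_split r p a qI qJ \<longleftrightarrow> 0 \<le> a \<and> a \<le> 1 \<and> qI \<in> Iset r \<and> qJ \<in> Delta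
      \<and> p = a *\<^sub>R qI + (1 - a) *\<^sub>R qJ"

definition greedy_split :: "('w::finite \<Rightarrow> real) \<Rightarrow> real^'w \<Rightarrow> real \<Rightarrow> real^'w \<Rightarrow> real^'w \<Rightarrow> bool" where
  "greedy_split r p a qI qJ \<longleftrightarrow> feasible_split r p a qI qJ
      \<and> (\<forall>a' qI' qJ'. feasible_split r p a' qI' qJ' \<longrightarrow> a' \<le> a)"

definition two_point :: "(real^'w::finite) measure \<Rightarrow> real \<Rightarrow> real^'w \<Rightarrow> real^'w \<Rightarrow> bool" where
  "two_point \<mu> a x y \<longleftrightarrow> sets \<mu> = sets borel \<and>
     (\<forall>A\<in>sets borel. emeasure \<mu> A = ennreal a * indicator A x + ennreal (1 - a) * indicator A y)"

definition is_greedy :: "('w::finite \<Rightarrow> real) \<Rightarrow> real^'w^'w \<Rightarrow> real^'w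
    \<Rightarrow> (nat \<Rightarrow> (nat \<Rightarrow> real^'w) \<Rightarrow> (real^'w) measure) \<Rightarrow> bool" where
  "is_greedy r M p1 \<sigma> \<longleftrightarrow>
     (\<forall>n h. (\<forall>i<n. h i \<in> Delta) \<longrightarrow>
        (cur_belief M p1 n h \<in> Iset r \<longrightarrow> \<sigma> n h = return borel (cur_belief M p1 n h))
      \<and> (cur_belief M p1 n h \<in> Jset r \<longrightarrow>
           (\<exists>a qI qJ. greedy_split r (cur_belief M p1 n h) a qI qJ \<and> two_point (\<sigma> n h) a qI qJ)))"

definition F_point :: "('w::finite \<Rightarrow> real) \<Rightarrow> real^'w \<Rightarrow> real^'w \<Rightarrow> real^'w" where
  "F_point r x y = (THE z. z \<in> closed_segment x y \<and> z \<in> Fset r)"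

end

theory Submission
  imports Defs
begin

text \<open>Let \<open>C\<close> minimise \<open>r\<close> and put \<open>x(p) = \<langle>p, r\<rangle> / \<bar>r(C)\<bar> \<ge> -1\<close>. The scalar \<open>x\<close> evolves autonomously, and
  every splitting of \<open>p\<close> induces a splitting of \<open>x(p)\<close>; hence the explicit concave value \<open>f\<close> of the scalar
  problem bounds the value from above by \<open>f(x(p))\<close>. Greedy splittings attain this bound wherever they use
  the posterior \<open>C\<close>, i.e. always in case (i), and on the triangle \<open>A, B\<^sup>+, C\<close> in case (ii). The
  assumption of case (ii) says that \<open>m\<close> lies in this triangle, which is therefore invariant. On the
  remaining triangle \<open>B\<^sup>+, B, C\<close> the greedy strategy splits between \<open>B\<^sup>+\<close> and the edge \<open>BC\<close>; its value is
  the decreasing limit of functions \<open>V\<^sub>k\<close> obtained by iterating this splitting from \<open>f \<circ> x\<close>. Each \<open>V\<^sub>k\<close> is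
  concave because it lies below the concave function \<open>f \<circ> x\<close>, with equality beyond the line \<open>B\<^sup>+C\<close>.\<close>

subsection \<open>Dynamic programming\<close>

lemma Delta_closed: "closed (Delta :: (real^'w::finite) set)"
proof -
  have *: "Delta = (\<Inter>i. {p :: real^'w. 0 \<le> p $ i}) \<inter> {p. (\<Sum>i\<in>UNIV. p $ i) = 1}"
    by (auto simp: Delta_def)
  show ?thesis
    unfolding * by (intro closed_Int closed_INT ballI closed_Collect_le closed_Collect_eq continuous_intros)
qed

lemma Delta_borel [measurable]: "(Delta :: (real^'w::finite) set) \<in> sets borel"
  using Delta_closed by (rule borel_closed)

lemma Delta_le_1: "p \<in> Delta \<Longrightarrow> p $ i \<le> 1"
  unfolding Delta_def by (auto intro: member_le_sum[of i UNIV "\<lambda>i. p $ i", simplified, THEN order_trans])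

lemma Delta_convex_comb:
  assumes "p \<in> Delta" "q \<in> Delta" "0 \<le> u" "u \<le> 1"
  shows "(1 - u) *\<^sub>R p + u *\<^sub>R q \<in> Delta"
  using assms by (auto simp: Delta_def sum.distrib sum_distrib_left[symmetric])

lemma axis_Delta: "axis i 1 \<in> Delta"
  by (auto simp: Delta_def axis_def sum.delta)

text \<open>A function on the simplex with a supporting linear functional at every point. On \<^const>\<open>Delta\<close>
  linear and affine functionals agree, and supports make Jensen's inequality immediate,
  without any measurability assumption on the function.\<close>

definition supported :: "(real^'w::finite \<Rightarrow> real) \<Rightarrow> bool" where
  "supported V \<longleftrightarrow> (\<forall>p\<in>Delta. \<exists>h. linear h \<and> h p = V p \<and> (\<forall>q\<in>Delta. V q \<le> h q))"

lemma supportedE: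
  assumes "supported V" "p \<in> Delta"
  obtains h where "linear h" "h p = V p" "\<And>q. q \<in> Delta \<Longrightarrow> V q \<le> h q"
  using assms unfolding supported_def by blast

text \<open>A linear majorant integrates to its value at the mean of \<open>\<mu>\<close>, so only
  monotonicity of the integral is asked of \<open>g\<close>; the integrands of \<open>Wpay\<close>
  are never shown to be measurable.\<close>

lemma nn_integral_Splits_le:
  assumes \<mu>: "\<mu> \<in> Splits p" and h: "linear h"
    and pos: "\<And>q. q \<in> Delta \<Longrightarrow> 0 \<le> h q"
    and g: "\<And>q. q \<in> Delta \<Longrightarrow> g q \<le> ennreal (h q)"
  shows "(\<integral>\<^sup>+q. g q \<partial>\<mu>) \<le> ennreal (h p)"
proof -
  interpret prob_space \<mu> using \<mu> by (simp add: Splits_def)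
  have sets: "sets \<mu> = sets borel" using \<mu> by (simp add: Splits_def)
  have "AE q in \<mu>. q \<in> Delta"
    using \<mu> sets by (intro AE_prob_1) (simp add: Splits_def measure_def)
  note AE = this
  have "has_bochner_integral \<mu> (\<lambda>q. h q) (h p)"
    using \<mu> h by (intro has_bochner_integral_bounded_linear[of h])
      (auto simp: Splits_def linear_conv_bounded_linear)
  then have int: "integrable \<mu> h" "integral\<^sup>L \<mu> h = h p"
    by (auto simp: has_bochner_integral_iff)
  have "(\<integral>\<^sup>+q. g q \<partial>\<mu>) \<le> (\<integral>\<^sup>+q. ennreal (h q) \<partial>\<mu>)"
    using AE by (intro nn_integral_mono_AE) (auto elim!: eventually_mono intro: g)
  also have "\<dots> = ennreal (h p)"
    using AE int by (subst nn_integral_eq_integral) (auto elim!: eventually_mono intro: pos)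
  finally show ?thesis .
qed

text \<open>Only a lower bound, as \<open>f\<close> need not be measurable: cutting \<open>f\<close>
  down to the atoms \<open>x\<close> and \<open>y\<close> leaves a simple function.\<close>

lemma nn_integral_two_point_ge:
  assumes \<mu>: "two_point \<mu> a x y" and a: "0 \<le> a" "a \<le> 1"
  shows "ennreal a * f x + ennreal (1 - a) * f y \<le> (\<integral>\<^sup>+q. f q \<partial>\<mu>)"
proof -
  have sets [measurable_cong]: "sets \<mu> = sets borel" using \<mu> by (simp add: two_point_def)
  have em: "emeasure \<mu> A = ennreal a * indicator A x + ennreal (1 - a) * indicator A y"
    if "A \<in> sets borel" for A
    using \<mu> that by (simp add: two_point_def)
  \<comment> \<open>Removing \<open>x\<close> from \<open>{y}\<close> keeps \<open>?g\<close> below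
    \<open>f\<close> when the two atoms coincide.\<close>
  let ?g = "\<lambda>q. f x * indicator {x} q + f y * indicator ({y} - {x}) q"
  have "(\<integral>\<^sup>+q. ?g q \<partial>\<mu>) = f x * emeasure \<mu> {x} + f y * emeasure \<mu> ({y} - {x})"
    by (subst nn_integral_add) (auto simp: nn_integral_cmult_indicator)
  also have "\<dots> = ennreal a * f x + ennreal (1 - a) * f y"
  proof (cases "x = y")
    case True
    have "ennreal a + ennreal (1 - a) = 1" using a by (simp flip: ennreal_plus)
    then show ?thesis using True by (simp add: em flip: distrib_right)
  qed (auto simp: em indicator_def mult.commute)
  finally have "ennreal a * f x + ennreal (1 - a) * f y = (\<integral>\<^sup>+q. ?g q \<partial>\<mu>)" ..
  also have "\<dots> \<le> (\<integral>\<^sup>+q. f q \<partial>\<mu>)"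
    by (intro nn_integral_mono) (auto simp: indicator_def)
  finally show ?thesis .
qed

lemma two_point_return: "two_point (return borel p) 1 p p"
  by (auto simp: two_point_def indicator_def)

lemma cur_belief_Delta:
  assumes "p1 \<in> Delta" "\<And>q. q \<in> Delta \<Longrightarrow> phi M q \<in> Delta" "\<forall>i<n. h i \<in> Delta"
  shows "cur_belief M p1 n h \<in> Delta"
  using assms by (auto simp: cur_belief_def)

lemma cur_belief_Suc: "cur_belief M p1 (Suc n) (h(n := q)) = phi M q"
  by (simp add: cur_belief_def)

text \<open>Bellman's upper bound, by induction on the horizon \<open>N\<close>. The level
  \<open>k\<close> is arbitrary in the induction because the step bounds stage \<open>n\<close> by
  \<open>V (Suc k)\<close> and the continuation by \<open>V k\<close>.\<close>

lemma Wpay_le: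
  fixes V :: "nat \<Rightarrow> real^'w::finite \<Rightarrow> real"
  assumes \<sigma>: "is_strategy M p1 \<sigma>" and p1: "p1 \<in> Delta" and \<delta>: "0 \<le> \<delta>" "\<delta> < 1"
    and phi: "\<And>q. q \<in> Delta \<Longrightarrow> phi M q \<in> Delta"
    and V0: "\<And>k q. q \<in> Delta \<Longrightarrow> 0 \<le> V k q"
    and sup: "\<And>k. supported (V k)"
    and dec: "\<And>k q. q \<in> Delta \<Longrightarrow> V (Suc k) q \<le> V k q"
    and step: "\<And>k q. q \<in> Delta \<Longrightarrow> (1 - \<delta>) * indicator (Iset r) q + \<delta> * V k (phi M q) \<le> V (Suc k) q"
    and h: "\<forall>i<n. h i \<in> Delta"
  shows "Wpay r \<delta> \<sigma> N n h \<le> ennreal (V k (cur_belief M p1 n h))"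
  using h
proof (induction N arbitrary: n h k)
  case 0
  then show ?case by simp
next
  case (Suc N)
  let ?p = "cur_belief M p1 n h"
  have p: "?p \<in> Delta" using cur_belief_Delta[OF p1 phi Suc.prems] .
  have \<mu>: "\<sigma> n h \<in> Splits ?p" using \<sigma> Suc.prems by (auto simp: is_strategy_def)
  \<comment> \<open>By \<open>step\<close> the integrand lies below \<open>V (Suc k)\<close>, hence
    below a linear support of \<open>V (Suc k)\<close> at the mean \<open>?p\<close>.\<close>
  have *: "Wpay r \<delta> \<sigma> (Suc N) n h \<le> ennreal (V (Suc k) ?p)" for k
  proof -
    obtain l where l: "linear l" "l ?p = V (Suc k) ?p" "\<And>q. q \<in> Delta \<Longrightarrow> V (Suc k) q \<le> l q"
      using supportedE[OF sup p] by metis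
    have "ennreal ((1 - \<delta>) * indicator (Iset r) q) + ennreal \<delta> * Wpay r \<delta> \<sigma> N (Suc n) (h(n := q))
        \<le> ennreal (l q)" if q: "q \<in> Delta" for q
    proof -
      have "Wpay r \<delta> \<sigma> N (Suc n) (h(n := q)) \<le> ennreal (V k (phi M q))"
        using Suc.IH[of "Suc n" "h(n := q)" k, unfolded cur_belief_Suc] Suc.prems q
        by (metis fun_upd_apply less_Suc_eq)
      then have "ennreal ((1 - \<delta>) * indicator (Iset r) q) + ennreal \<delta> * Wpay r \<delta> \<sigma> N (Suc n) (h(n := q))
          \<le> ennreal ((1 - \<delta>) * indicator (Iset r) q) + ennreal \<delta> * ennreal (V k (phi M q))"
        by (intro add_left_mono mult_left_mono) auto
      also have "\<dots> = ennreal ((1 - \<delta>) * indicator (Iset r) q + \<delta> * V k (phi M q))"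
        using \<delta> V0[OF phi[OF q]] by (simp add: ennreal_mult' ennreal_plus)
      also have "\<dots> \<le> ennreal (l q)"
        using step[OF q, of k] l(3)[OF q] by (intro ennreal_leI) linarith
      finally show ?thesis .
    qed
    then show ?thesis
      unfolding Wpay.simps l(2)[symmetric]
      by (intro nn_integral_Splits_le[OF \<mu> l(1)]) (auto intro: order_trans[OF V0 l(3)])
  qed
  show ?case
  proof (cases k)
    case 0
    \<comment> \<open>Level 0 has no predecessor; it is reached from level 1 by
      monotonicity.\<close>
    have "ennreal (V (Suc 0) ?p) \<le> ennreal (V 0 ?p)"
      using dec[OF p, of 0] by (rule ennreal_leI)
    then show ?thesis using *[of 0] 0 by (auto intro: order_trans)
  qed (use * in auto)
qed

text \<open>Here horizon and level agree. At horizon 0 the error is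
  \<open>\<delta> ^ 0 = 1 \<ge> V 0\<close>, and each stage discounts it by
  \<open>\<delta>\<close>.\<close>

lemma Wpay_greedy_ge:
  fixes V :: "nat \<Rightarrow> real^'w::finite \<Rightarrow> real"
  assumes gr: "is_greedy r M p1 \<sigma>" and p1: "p1 \<in> Delta" and \<delta>: "0 \<le> \<delta>" "\<delta> < 1"
    and phi: "\<And>q. q \<in> Delta \<Longrightarrow> phi M q \<in> Delta"
    and V1: "\<And>q. q \<in> Delta \<Longrightarrow> V 0 q \<le> 1"
    and stepI: "\<And>k p. p \<in> Iset r \<Longrightarrow> V (Suc k) p \<le> 1 - \<delta> + \<delta> * V k (phi M p)"
    and stepJ: "\<And>k p a qI qJ. p \<in> Jset r \<Longrightarrow> greedy_split r p a qI qJ \<Longrightarrow>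
      V (Suc k) p \<le> a * (1 - \<delta> + \<delta> * V k (phi M qI)) + (1 - a) * (\<delta> * V k (phi M qJ))"
    and h: "\<forall>i<n. h i \<in> Delta"
  shows "ennreal (V k (cur_belief M p1 n h) - \<delta> ^ k) \<le> Wpay r \<delta> \<sigma> k n h"
  using h
proof (induction k arbitrary: n h)
  case 0
  then show ?case using V1[OF cur_belief_Delta[OF p1 phi]] by (simp add: ennreal_neg)
next
  case (Suc k)
  let ?p = "cur_belief M p1 n h"
  let ?f = "\<lambda>q. ennreal ((1 - \<delta>) * indicator (Iset r) q) + ennreal \<delta> * Wpay r \<delta> \<sigma> k (Suc n) (h(n := q))"
  let ?g = "\<lambda>q. (1 - \<delta>) * indicator (Iset r) q + \<delta> * (V k (phi M q) - \<delta> ^ k)"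
  have p: "?p \<in> Delta" using cur_belief_Delta[OF p1 phi Suc.prems] .
  \<comment> \<open>\<open>V k - \<delta> ^ k\<close> may be negative, and \<open>ennreal\<close>
    truncates at 0; truncation is subadditive, which is the direction needed.\<close>
  have add_le: "ennreal (u + v) \<le> ennreal u + ennreal v" for u v
    by (cases "0 \<le> u"; cases "0 \<le> v")
      (auto simp: ennreal_neg ennreal_plus intro: ennreal_leI)
  have f: "ennreal (?g q) \<le> ?f q" if q: "q \<in> Delta" for q
  proof -
    have "ennreal (V k (phi M q) - \<delta> ^ k) \<le> Wpay r \<delta> \<sigma> k (Suc n) (h(n := q))"
      using Suc.IH[of "Suc n" "h(n := q)", unfolded cur_belief_Suc] Suc.prems q
      by (metis fun_upd_apply less_Suc_eq)
    then have "ennreal ((1 - \<delta>) * indicator (Iset r) q) + ennreal \<delta> * ennreal (V k (phi M q) - \<delta> ^ k) \<le> ?f q"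
      by (intro add_left_mono mult_left_mono) auto
    moreover have "ennreal (?g q) \<le> ennreal ((1 - \<delta>) * indicator (Iset r) q) + ennreal \<delta> * ennreal (V k (phi M q) - \<delta> ^ k)"
      using \<delta> by (simp add: ennreal_mult'[symmetric] add_le)
    ultimately show ?thesis by (rule order_trans[rotated])
  qed
  have two: "ennreal (a * ?g x + (1 - a) * ?g y) \<le> Wpay r \<delta> \<sigma> (Suc k) n h"
    if \<mu>: "two_point (\<sigma> n h) a x y" and a: "0 \<le> a" "a \<le> 1" and xy: "x \<in> Delta" "y \<in> Delta" for a x y
  proof -
    have "ennreal (a * ?g x + (1 - a) * ?g y) \<le> ennreal a * ennreal (?g x) + ennreal (1 - a) * ennreal (?g y)"
      using a by (simp only: ennreal_mult'[symmetric] diff_ge_0_iff_ge add_le)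
    also have "\<dots> \<le> ennreal a * ?f x + ennreal (1 - a) * ?f y"
      by (intro add_mono mult_left_mono f xy) auto
    also have "\<dots> \<le> Wpay r \<delta> \<sigma> (Suc k) n h"
      unfolding Wpay.simps by (rule nn_integral_two_point_ge[OF \<mu> a])
    finally show ?thesis .
  qed
  show ?case
  proof (cases "?p \<in> Iset r")
    case True
    then have "\<sigma> n h = return borel ?p" using gr Suc.prems by (auto simp: is_greedy_def)
    then have "ennreal (?g ?p) \<le> Wpay r \<delta> \<sigma> (Suc k) n h"
      using two[of 1 ?p ?p] two_point_return[of ?p] p by simp
    moreover have "V (Suc k) ?p - \<delta> ^ Suc k \<le> ?g ?p"
      using stepI[OF True, of k] True by (simp add: algebra_simps)
    ultimately show ?thesis by (blast intro: order_trans ennreal_leI)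
  next
    case False
    then have J: "?p \<in> Jset r" using p by (simp add: Jset_def)
    then obtain a qI qJ where s: "greedy_split r ?p a qI qJ" and \<mu>: "two_point (\<sigma> n h) a qI qJ"
      using gr Suc.prems unfolding is_greedy_def by blast
    have a: "0 \<le> a" "a \<le> 1" "qI \<in> Iset r" "qI \<in> Delta" "qJ \<in> Delta"
      using s by (auto simp: greedy_split_def feasible_split_def Iset_def)
    have "ennreal (a * ?g qI + (1 - a) * ?g qJ) \<le> Wpay r \<delta> \<sigma> (Suc k) n h"
      by (rule two[OF \<mu>]) (use a in auto)
    moreover have "V (Suc k) ?p - \<delta> ^ Suc k \<le> a * ?g qI + (1 - a) * ?g qJ"
    proof -
      have "0 \<le> (1 - a) * ((1 - \<delta>) * indicator (Iset r) qJ)" using a \<delta> by simp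
      then show ?thesis
        using stepJ[OF J s, of k] a(3) by (simp add: algebra_simps)
    qed
    ultimately show ?thesis by (blast intro: order_trans ennreal_leI)
  qed
qed

text \<open>The functions \<open>V k\<close> bound every payoff from above, while the greedy strategy earns \<open>V k - \<delta>\<^sup>k\<close>
  within \<open>k\<close> stages; so no limit of \<open>V k\<close> is needed.\<close>

lemma greedy_optimal:
  fixes V :: "nat \<Rightarrow> real^'w::finite \<Rightarrow> real"
  assumes p1: "p1 \<in> Delta" and \<delta>: "0 \<le> \<delta>" "\<delta> < 1"
    and phi: "\<And>q. q \<in> Delta \<Longrightarrow> phi M q \<in> Delta"
    and V0: "\<And>k q. q \<in> Delta \<Longrightarrow> 0 \<le> V k q"
    and V1: "\<And>q. q \<in> Delta \<Longrightarrow> V 0 q \<le> 1"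
    and sup: "\<And>k. supported (V k)"
    and dec: "\<And>k q. q \<in> Delta \<Longrightarrow> V (Suc k) q \<le> V k q"
    and step: "\<And>k q. q \<in> Delta \<Longrightarrow> (1 - \<delta>) * indicator (Iset r) q + \<delta> * V k (phi M q) \<le> V (Suc k) q"
    and stepI: "\<And>k p. p \<in> Iset r \<Longrightarrow> V (Suc k) p \<le> 1 - \<delta> + \<delta> * V k (phi M p)"
    and stepJ: "\<And>k p a qI qJ. p \<in> Jset r \<Longrightarrow> greedy_split r p a qI qJ \<Longrightarrow>
      V (Suc k) p \<le> a * (1 - \<delta> + \<delta> * V k (phi M qI)) + (1 - a) * (\<delta> * V k (phi M qJ))"
    and str: "is_strategy M p1 \<sigma>" and gr: "is_greedy r M p1 \<sigma>"
  shows "optimal r \<delta> M p1 \<sigma>"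
proof -
  have le: "value_fn r \<delta> M p1 \<le> ennreal (V k p1)" for k
    unfolding value_fn_def payoff_def
    using Wpay_le[where V = V, OF _ p1 \<delta> phi V0 sup dec step, of _ 0 "\<lambda>_. 0" _ k]
    by (auto intro!: SUP_least simp: cur_belief_def)
  have ge: "ennreal (V k p1) \<le> payoff r \<delta> \<sigma> + ennreal (\<delta> ^ k)" for k
  proof -
    have "ennreal (V k p1 - \<delta> ^ k) \<le> Wpay r \<delta> \<sigma> k 0 (\<lambda>_. 0)"
      using Wpay_greedy_ge[where V = V, OF gr p1 \<delta> phi V1 stepI stepJ, of 0 "\<lambda>_. 0" k] by (auto simp: cur_belief_def)
    also have "\<dots> \<le> payoff r \<delta> \<sigma>" unfolding payoff_def by (rule SUP_upper) simp
    finally have "ennreal (V k p1 - \<delta> ^ k) + ennreal (\<delta> ^ k) \<le> payoff r \<delta> \<sigma> + ennreal (\<delta> ^ k)"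
      by (rule add_right_mono)
    moreover have "ennreal (V k p1) \<le> ennreal (V k p1 - \<delta> ^ k) + ennreal (\<delta> ^ k)"
      using \<delta> by (cases "V k p1 \<le> \<delta> ^ k") (auto intro: ennreal_leI simp: ennreal_neg simp flip: ennreal_plus)
    ultimately show ?thesis by (rule order_trans[rotated])
  qed
  have "(\<lambda>k. payoff r \<delta> \<sigma> + ennreal (\<delta> ^ k)) \<longlonglongrightarrow> payoff r \<delta> \<sigma> + ennreal 0"
    using \<delta> by (intro tendsto_add tendsto_const tendsto_ennrealI LIMSEQ_realpow_zero) auto
  then have "value_fn r \<delta> M p1 \<le> payoff r \<delta> \<sigma> + ennreal 0"
    by (rule tendsto_lowerbound[OF _ always_eventually]) (use le ge in \<open>auto intro: order_trans\<close>)
  moreover have "payoff r \<delta> \<sigma> \<le> value_fn r \<delta> M p1"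
    unfolding value_fn_def using str by (auto intro: SUP_upper)
  ultimately show ?thesis using str by (auto simp: optimal_def intro: antisym)
qed

subsection \<open>Existence of a greedy strategy\<close>

definition two_pt :: "real \<Rightarrow> real^'w::finite \<Rightarrow> real^'w \<Rightarrow> (real^'w) measure" where
  "two_pt a x y = distr (measure_pmf (bernoulli_pmf a)) borel (\<lambda>b. if b then x else y)"

lemma two_point_two_pt:
  assumes "0 \<le> a" "a \<le> 1"
  shows "two_point (two_pt a x y) a x y"
proof -
  have "emeasure (two_pt a x y) A = ennreal a * indicator A x + ennreal (1 - a) * indicator A y"
    if [measurable]: "A \<in> sets borel" for A
  proof -
    have "emeasure (two_pt a x y) A = (\<integral>\<^sup>+ q. indicator A q \<partial>two_pt a x y)"
      by (simp add: two_pt_def)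
    also have "\<dots> = (\<integral>\<^sup>+ b. indicator A (if b then x else y) \<partial>bernoulli_pmf a)"
      unfolding two_pt_def by (subst nn_integral_distr) auto
    also have "\<dots> = ennreal a * indicator A x + ennreal (1 - a) * indicator A y"
      using assms by (subst nn_integral_bernoulli_pmf) (auto simp: mult.commute)
    finally show ?thesis .
  qed
  then show ?thesis by (simp add: two_point_def two_pt_def)
qed

lemma two_pt_Splits:
  assumes "0 \<le> a" "a \<le> 1" "x \<in> Delta" "y \<in> Delta"
  shows "two_pt a x y \<in> Splits (a *\<^sub>R x + (1 - a) *\<^sub>R y)"
proof -
  have em: "emeasure (two_pt a x y) A = ennreal a * indicator A x + ennreal (1 - a) * indicator A y"
    if "A \<in> sets borel" for A
    using two_point_two_pt[OF assms(1,2), of x y] that by (simp add: two_point_def)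
  have "prob_space (two_pt a x y)"
    unfolding two_pt_def by (intro measure_pmf.prob_space_distr) auto
  moreover have "has_bochner_integral (two_pt a x y) (\<lambda>q. q) (a *\<^sub>R x + (1 - a) *\<^sub>R y)"
  proof -
    have "integrable (measure_pmf (bernoulli_pmf a)) (\<lambda>b. if b then x else y)"
      by (intro integrable_measure_pmf_finite) auto
    moreover have "(\<integral>b. (if b then x else y) \<partial>measure_pmf (bernoulli_pmf a)) = a *\<^sub>R x + (1 - a) *\<^sub>R y"
      using assms by (subst integral_measure_pmf[of UNIV]) (auto simp: UNIV_bool)
    ultimately show ?thesis
      unfolding two_pt_def by (intro has_bochner_integral_distr) (auto simp: has_bochner_integral_iff o_def)
  qed
  ultimately show ?thesis
    using em[of Delta] assms by (auto simp: Splits_def two_pt_def simp flip: ennreal_plus)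
qed

lemma continuous_on_rpay: "continuous_on UNIV (rpay r)"
  unfolding rpay_def by (intro continuous_intros)

lemma rpay_measurable [measurable]: "rpay r \<in> borel_measurable borel"
  using continuous_on_rpay by (rule borel_measurable_continuous_onI)

lemma nth_measurable [measurable]: "(\<lambda>p :: real^'w::finite. p $ i) \<in> borel_measurable borel"
  by (intro borel_measurable_continuous_onI continuous_intros)

lemma Iset_borel [measurable]: "Iset r \<in> sets borel"
  unfolding Iset_def by measurable

text \<open>The strategy is Markovian: it applies a kernel \<open>\<kappa>\<close> to the current
  belief. Measurable selectors make \<open>\<kappa>\<close> a measurable kernel.\<close>

lemma exists_greedy_strategy:
  fixes r :: "'w::finite \<Rightarrow> real"
  assumes p1: "p1 \<in> Delta" and phi: "\<And>q. q \<in> Delta \<Longrightarrow> phi M q \<in> Delta"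
    and [measurable]: "a \<in> borel_measurable borel" "qI \<in> borel_measurable borel" "qJ \<in> borel_measurable borel"
    and gs: "\<And>p. p \<in> Jset r \<Longrightarrow> greedy_split r p (a p) (qI p) (qJ p)"
  shows "\<exists>\<sigma>. is_strategy M p1 \<sigma> \<and> is_greedy r M p1 \<sigma>"
proof -
  \<comment> \<open>Outside \<open>Jset r\<close> nothing is known about \<open>a\<close>; clamping
    makes \<open>c\<close> a probability at every vector and changes nothing on
    \<open>Jset r\<close>, where \<open>a p\<close> is feasible.\<close>
  define c where "c p = (if p \<in> Iset r then 1 else min 1 (max 0 (a p)))" for p
  define x where "x p = (if p \<in> Iset r then p else qI p)" for p
  define \<kappa> where "\<kappa> p = two_pt (c p) (x p) (qJ p)" for p
  have c01: "0 \<le> c p" "c p \<le> 1" for p by (auto simp: c_def)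
  have [measurable]: "c \<in> borel_measurable borel" "x \<in> borel_measurable borel"
    unfolding c_def x_def by measurable
  have em: "emeasure (\<kappa> p) A = ennreal (c p) * indicator A (x p) + ennreal (1 - c p) * indicator A (qJ p)"
    if "A \<in> sets borel" for A p
    using two_point_two_pt[OF c01, of p "x p" "qJ p"] that by (simp add: two_point_def \<kappa>_def)
  have sets_\<kappa>: "sets (\<kappa> p) = sets borel" for p by (simp add: \<kappa>_def two_pt_def)
  have prob_\<kappa>: "prob_space (\<kappa> p)" for p
    unfolding \<kappa>_def two_pt_def by (intro measure_pmf.prob_space_distr) auto
  have [measurable]: "\<kappa> \<in> measurable borel (subprob_algebra borel)"
  proof (rule measurable_subprob_algebra)
    show "subprob_space (\<kappa> p)" for p using prob_\<kappa> by (rule prob_space_imp_subprob_space)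
    show "(\<lambda>p. emeasure (\<kappa> p) A) \<in> borel_measurable borel" if [measurable]: "A \<in> sets borel" for A
      unfolding em[OF that] by measurable
  qed (simp add: sets_\<kappa>)
  have [measurable]: "phi M \<in> borel_measurable borel"
    unfolding phi_def vector_matrix_mult_def
    by (intro borel_measurable_continuous_onI continuous_intros)
  let ?\<sigma> = "\<lambda>n h. \<kappa> (cur_belief M p1 n h)"
  have I: "\<kappa> p = return borel p" if "p \<in> Iset r" for p
    by (rule measure_eqI) (use that in \<open>auto simp: sets_\<kappa> em c_def x_def\<close>)
  have J: "greedy_split r p (a p) (qI p) (qJ p) \<and> two_point (\<kappa> p) (a p) (qI p) (qJ p)" if "p \<in> Jset r" for p
    using that gs[OF that] two_point_two_pt[OF c01, of p "x p" "qJ p"]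
    by (auto simp: \<kappa>_def c_def x_def Jset_def greedy_split_def feasible_split_def)
  have S: "\<kappa> p \<in> Splits p" if p: "p \<in> Delta" for p
  proof (cases "p \<in> Iset r")
    case True
    then have "\<kappa> p = two_pt 1 p p"
      by (intro measure_eqI)
        (use two_point_two_pt[of 1 p p] in \<open>auto simp: sets_\<kappa> em c_def x_def two_point_def two_pt_def\<close>)
    then show ?thesis using two_pt_Splits[of 1 p p] p by simp
  next
    case False
    then have "p \<in> Jset r" using p by (simp add: Jset_def)
    from gs[OF this] have f: "feasible_split r p (a p) (qI p) (qJ p)" by (simp add: greedy_split_def)
    then have "\<kappa> p = two_pt (a p) (qI p) (qJ p)"
      using False by (simp add: \<kappa>_def c_def x_def feasible_split_def)
    then show ?thesis
      using two_pt_Splits[of "a p" "qI p" "qJ p"] f by (auto simp: feasible_split_def Iset_def)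
  qed
  have "is_strategy M p1 ?\<sigma>"
    unfolding is_strategy_def
  proof (intro allI conjI impI)
    fix n
    show "?\<sigma> n \<in> measurable (PiM UNIV (\<lambda>_. borel)) (subprob_algebra borel)"
      by (cases n) (simp_all add: cur_belief_def)
    show "?\<sigma> n h \<in> Splits (cur_belief M p1 n h)" if "\<forall>i<n. h i \<in> Delta" for h
      using S cur_belief_Delta[OF p1 phi that] by blast
  qed
  moreover have "is_greedy r M p1 ?\<sigma>"
    unfolding is_greedy_def using I J by blast
  ultimately show ?thesis by blast
qed

subsection \<open>The scalar problem\<close>

text \<open>Value function of the problem reduced to the scalar belief \<open>x = \<langle>p, r\<rangle> / \<bar>min r\<bar>\<close>, whose
  dynamics is \<open>x \<mapsto> lam x + (1 - lam) \<mu>\<close>.\<close>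

locale scalar_value =
  fixes \<mu> lam \<delta> :: real and f :: "real \<Rightarrow> real"
  assumes lam: "0 \<le> lam" "lam < 1" and \<delta>: "0 \<le> \<delta>" "\<delta> < 1" and \<mu>: "-1 \<le> \<mu>"
    and f_nonneg: "-1 \<le> x \<Longrightarrow> 0 \<le> f x"
    and f_le_1: "-1 \<le> x \<Longrightarrow> f x \<le> 1"
    and f_support: "-1 \<le> x \<Longrightarrow> \<exists>c d. f x = c + d * x \<and> (\<forall>y\<ge>-1. f y \<le> c + d * y)"
    and f_pos: "0 \<le> x \<Longrightarrow> f x = 1 - \<delta> + \<delta> * f (lam * x + (1 - lam) * \<mu>)"
    and f_neg: "-1 \<le> x \<Longrightarrow> x \<le> 0 \<Longrightarrow> f x = (1 + x) * f 0 - x * f (-1)"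
    and f_worst: "f (-1) = \<delta> * f (lam * (-1) + (1 - lam) * \<mu>)"
    and f_discount: "-1 \<le> x \<Longrightarrow> x \<le> 0 \<Longrightarrow> \<delta> * f (lam * x + (1 - lam) * \<mu>) \<le> f x"
    and f_mono: "f (-1) \<le> f 0"
    and f_ray: "-1 \<le> x \<Longrightarrow> x \<le> 0 \<Longrightarrow> 0 \<le> t \<Longrightarrow>
      (1 + t) * f ((lam * x + (1 - lam) * \<mu>) / (1 + t)) = f (lam * x + (1 - lam) * \<mu>) + t * f 0"

lemma convex_combination_ge:
  fixes lam x \<mu> b :: real
  assumes "0 \<le> lam" "lam \<le> 1" "b \<le> x" "b \<le> \<mu>"
  shows "b \<le> lam * x + (1 - lam) * \<mu>"
proof -
  have "0 \<le> lam * (x - b) + (1 - lam) * (\<mu> - b)" using assms by (intro add_nonneg_nonneg mult_nonneg_nonneg) auto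
  then show ?thesis by (simp add: algebra_simps)
qed

text \<open>For \<open>0 \<le> \<mu>\<close> the half-line \<open>0 \<le> x\<close> is absorbing and
  worth 1; below 0 the value is the chord from \<open>w\<close> at -1 to 1 at 0.\<close>

lemma scalar_value_exists_pos:
  fixes \<mu> lam \<delta> :: real
  assumes lam: "0 \<le> lam" "lam < 1" and \<delta>: "0 \<le> \<delta>" "\<delta> < 1" and \<mu>: "0 \<le> \<mu>"
  shows "\<exists>f. scalar_value \<mu> lam \<delta> f"
proof -
  \<comment> \<open>The successor of the worst belief -1, capped at 0, where \<open>f\<close>
    becomes constant.\<close>
  define y where "y = min 0 ((1 - lam) * \<mu> - lam)"
  have y: "-1 < y" "y \<le> 0" using lam \<mu> by (auto simp: y_def intro: order.strict_trans2[of _ "-lam"])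
  have "\<delta> * y \<ge> - \<delta>" using mult_left_mono[of "-1" y \<delta>] y \<delta> by simp
  then have den: "0 < 1 + \<delta> * y" using \<delta> by linarith
  \<comment> \<open>The solution of \<open>w = \<delta> * (1 + y * (1 - w))\<close>, which is the
    Bellman equation \<open>f_worst\<close> at -1.\<close>
  define w where "w = \<delta> * (1 + y) / (1 + \<delta> * y)"
  have w0: "0 \<le> w" using den y \<delta> by (simp add: w_def)
  have w1: "w \<le> 1" using den \<delta> by (simp add: w_def algebra_simps)
  have w: "\<delta> * (1 + y * (1 - w)) = w" using den by (simp add: w_def field_simps)
  define f where "f x = min 1 (1 + x * (1 - w))" for x
  have pos: "f x = 1" if "0 \<le> x" for x using that w1 by (simp add: f_def)
  have neg: "f x = 1 + x * (1 - w)" if "x \<le> 0" for x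
    using that w1 mult_nonpos_nonneg[of x "1 - w"] by (simp add: f_def)
  let ?xi = "\<lambda>x. lam * x + (1 - lam) * \<mu>"
  have xi0: "f (?xi (-1)) = 1 + y * (1 - w)"
    by (cases "0 \<le> ?xi (-1)") (auto simp: pos neg y_def min_def)
  show ?thesis
  proof (intro exI[of _ f] scalar_value.intro)
    fix x :: real assume x: "-1 \<le> x"
    have "0 \<le> (1 + x) * (1 - w) + w" using x w0 w1 by simp
    then show "0 \<le> f x" by (simp add: f_def algebra_simps)
    show "f x \<le> 1" by (simp add: f_def)
    show "\<exists>c d. f x = c + d * x \<and> (\<forall>y\<ge>-1. f y \<le> c + d * y)"
    proof (cases "0 \<le> x")
      case True
      then have "f x = 1 + 0 * x \<and> (\<forall>y\<ge>-1. f y \<le> 1 + 0 * y)" by (auto simp: pos) (simp add: f_def)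
      then show ?thesis by blast
    next
      case False
      then have "f x = 1 + (1 - w) * x \<and> (\<forall>y\<ge>-1. f y \<le> 1 + (1 - w) * y)"
        by (auto simp: neg mult.commute) (simp add: f_def mult.commute)
      then show ?thesis by blast
    qed
  next
    fix x :: real assume "0 \<le> x"
    moreover from this have "0 \<le> ?xi x" using lam \<mu> by simp
    ultimately show "f x = 1 - \<delta> + \<delta> * f (?xi x)" by (simp add: pos)
  next
    fix x :: real assume x: "-1 \<le> x" "x \<le> 0"
    then show "f x = (1 + x) * f 0 - x * f (-1)" by (simp add: neg algebra_simps)
    \<comment> \<open>\<open>f\<close> grows with slope at most \<open>1 - w\<close>, so the claim
      follows from the equation at -1 and \<open>\<delta> * lam \<le> 1\<close>.\<close>
    have "?xi x = ?xi (-1) + lam * (1 + x)" by (simp add: algebra_simps)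
    moreover have "0 \<le> lam * (1 + x)" using lam x by simp
    moreover have "f (u + s) \<le> f u + s * (1 - w)" if "0 \<le> s" for u s
      using mult_nonneg_nonneg[OF that, of "1 - w"] w1 by (simp add: f_def min_def distrib_right)
    ultimately have "f (?xi x) \<le> f (?xi (-1)) + lam * (1 + x) * (1 - w)" by metis
    then have "\<delta> * f (?xi x) \<le> \<delta> * (1 + y * (1 - w) + lam * (1 + x) * (1 - w))"
      using xi0 \<delta> by (intro mult_left_mono) auto
    also have "\<dots> = w + (\<delta> * lam) * ((1 + x) * (1 - w))"
      using w by (simp add: algebra_simps)
    also have "\<dots> \<le> w + 1 * ((1 + x) * (1 - w))"
      using lam \<delta> x w1 mult_mono[of \<delta> 1 lam 1] by (intro add_left_mono mult_right_mono) auto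
    also have "\<dots> = f x" using x by (simp add: neg algebra_simps)
    finally show "\<delta> * f (?xi x) \<le> f x" .
  next
    fix x t :: real assume x: "-1 \<le> x" "x \<le> 0" and t: "0 \<le> t"
    let ?u = "?xi x"
    show "(1 + t) * f (?u / (1 + t)) = f ?u + t * f 0"
    proof (cases "0 \<le> ?u")
      case True then show ?thesis using t by (simp add: pos)
    next
      case False
      then have "?u / (1 + t) \<le> 0" using t by (simp add: divide_nonpos_pos)
      then have "(1 + t) * f (?u / (1 + t)) = (1 + t) * (1 + ?u / (1 + t) * (1 - w))"
        by (simp only: neg)
      also have "\<dots> = 1 + t + ?u * (1 - w)" using t by (simp add: field_simps)
      finally show ?thesis using False by (simp add: neg)
    qed
  qed (use assms w1 w xi0 in \<open>auto simp: neg\<close>)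
qed

text \<open>For \<open>\<mu> < 0\<close> the value is \<open>1 - \<delta>\<^sup>n + \<delta>\<^sup>n l (\<xi>\<^sup>n x)\<close> with \<open>\<xi> x = lam x + (1 - lam) \<mu>\<close>, \<open>n\<close> the first time
  at which \<open>\<xi>\<^sup>n x \<le> 0\<close>, and \<open>l\<close> the affine solution of \<open>l x - \<delta> l (\<xi> x) = (1 - \<delta>) (1 + x)\<close>;
  this \<open>n\<close> also minimises the expression.\<close>

lemma scalar_value_exists_neg:
  fixes \<mu> lam \<delta> :: real
  assumes lam: "0 \<le> lam" "lam < 1" and \<delta>: "0 \<le> \<delta>" "\<delta> < 1" and \<mu>: "-1 \<le> \<mu>" "\<mu> < 0"
  shows "\<exists>f. scalar_value \<mu> lam \<delta> f"
proof -
  let ?xi = "\<lambda>x. lam * x + (1 - lam) * \<mu>"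
  have dl: "\<delta> * lam < 1" using mult_strict_mono'[of \<delta> 1 lam 1] lam \<delta> by simp
  \<comment> \<open>The slope of \<open>l\<close>, found by matching the coefficients of
    \<open>x\<close> in its equation.\<close>
  define s where "s = (1 - \<delta>) / (1 - \<delta> * lam)"
  have s0: "0 \<le> s" using \<delta> dl by (simp add: s_def)
  have "\<delta> * lam \<le> \<delta>" using mult_left_mono[of lam 1 \<delta>] lam \<delta> by simp
  then have s1: "s \<le> 1" using dl by (simp add: s_def)
  have s: "s * (1 - \<delta> * lam) = 1 - \<delta>" using dl by (simp add: s_def)
  define l where "l x = 1 + \<mu> + s * (x - \<mu>)" for x
  \<comment> \<open>\<open>L n x\<close> is
    \<open>1 - \<delta> ^ n + \<delta> ^ n * l (it n x)\<close> written out, and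
    \<open>it n x\<close> is the \<open>n\<close>-th iterate of \<open>?xi\<close>.\<close>
  define L where "L n x = 1 + \<delta> ^ n * (\<mu> + s * lam ^ n * (x - \<mu>))" for n :: nat and x
  define it where "it n x = \<mu> + lam ^ n * (x - \<mu>)" for n :: nat and x
  have L0: "L 0 x = l x" for x by (simp add: L_def l_def)
  have LSuc: "L (Suc n) x = 1 - \<delta> + \<delta> * L n (?xi x)" for n x
    by (simp add: L_def algebra_simps)
  \<comment> \<open>\<open>L\<close> decreases in \<open>n\<close> while the iterates are
    nonnegative and increases once they are nonpositive, so \<open>N x\<close> minimises it. As a
    minimum of affine functions, \<open>f\<close> is concave.\<close>
  have Ldiff: "L (Suc n) x - L n x = - (\<delta> ^ n * (1 - \<delta>) * it n x)" for n x
  proof -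
    have "L (Suc n) x - L n x = \<delta> ^ n * ((\<delta> - 1) * \<mu> - (s * (1 - \<delta> * lam)) * (lam ^ n * (x - \<mu>)))"
      by (simp add: L_def algebra_simps)
    then show ?thesis unfolding s it_def by (simp add: algebra_simps)
  qed
  have D: "l x - \<delta> * l (?xi x) = (1 - \<delta>) * (1 + x)" for x
  proof -
    have "l x - \<delta> * l (?xi x) = (1 - \<delta>) * (1 + \<mu>) + s * (1 - \<delta> * lam) * (x - \<mu>)"
      by (simp add: l_def algebra_simps)
    then show ?thesis unfolding s by (simp add: algebra_simps)
  qed
  have it_dec: "it n x \<le> 0 \<Longrightarrow> it (n + k) x \<le> 0" for n k x
  proof (induction k)
    case (Suc k)
    have "it (n + Suc k) x = lam * it (n + k) x + (1 - lam) * \<mu>" by (simp add: it_def algebra_simps)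
    also have "\<dots> \<le> 0" using Suc lam \<mu> by (intro add_nonpos_nonpos mult_nonneg_nonpos) auto
    finally show ?case .
  qed simp
  have ex: "\<exists>n. it n x \<le> 0" for x
  proof -
    have "(\<lambda>n. it n x) \<longlonglongrightarrow> \<mu> + 0 * (x - \<mu>)" unfolding it_def
      using lam by (intro tendsto_intros LIMSEQ_realpow_zero) auto
    then have "eventually (\<lambda>n. it n x < 0) sequentially"
      using \<mu> by (intro order_tendstoD) auto
    then show ?thesis by (auto simp: eventually_sequentially intro: less_imp_le)
  qed
  define N where "N x = (LEAST n. it n x \<le> 0)" for x
  have N: "it (N x) x \<le> 0" for x unfolding N_def using ex by (rule LeastI_ex)
  have notN: "0 \<le> it n x" if "n < N x" for n x
    using not_less_Least[of n "\<lambda>n. it n x \<le> 0"] that by (auto simp: N_def)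
  define f where "f x = L (N x) x" for x
  have f_le: "f x \<le> L n x" for x n
  proof (cases "N x \<le> n")
    case True
    have "L (N x) x \<le> L (N x + k) x" for k
    proof (induction k)
      case (Suc k)
      have "0 \<le> L (Suc (N x + k)) x - L (N x + k) x"
        unfolding Ldiff using \<delta> it_dec[OF N, of x k] by (simp add: mult_nonneg_nonpos)
      with Suc show ?case by simp
    qed simp
    from this[of "n - N x"] show ?thesis using True by (simp add: f_def)
  next
    case False
    then have "n \<le> N x" by simp
    then show ?thesis
    proof (induction rule: inc_induct)
      case base then show ?case by (simp add: f_def)
    next
      case (step n)
      have "L (Suc n) x - L n x \<le> 0"
        unfolding Ldiff using \<delta> notN[OF step(2)] by simp
      with step show ?case by simp
    qed
  qed
  have neg: "f x = l x" if "x \<le> 0" for x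
  proof -
    have "N x = 0" unfolding N_def by (rule Least_equality) (use that in \<open>auto simp: it_def\<close>)
    then show ?thesis by (simp add: f_def L0)
  qed
  have xi_neg: "?xi x < 0" if "x \<le> 0" for x
    using that lam \<mu> by (intro add_nonpos_neg mult_nonneg_nonpos mult_pos_neg) auto
  \<comment> \<open>\<open>L n x\<close> is 1 plus a convex combination of \<open>x\<close>,
    \<open>\<mu>\<close> and 0, all at least -1.\<close>
  have L_ge: "0 \<le> L n x" if "-1 \<le> x" for n x
  proof -
    have "\<bar>\<delta> ^ n\<bar> \<le> 1" "\<bar>lam ^ n\<bar> \<le> 1" using \<delta> lam by (auto simp: power_le_one)
    then have n: "0 \<le> \<delta> ^ n" "\<delta> ^ n \<le> 1" "0 \<le> lam ^ n" "lam ^ n \<le> 1" using \<delta> lam by auto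
    have c: "0 \<le> s * lam ^ n" "s * lam ^ n \<le> 1" using n s0 s1 by (auto simp: mult_le_one)
    have m1: "-1 \<le> s * lam ^ n * x + (1 - s * lam ^ n) * \<mu>"
      by (rule convex_combination_ge) (use c that \<mu> in auto)
    have "-1 \<le> \<delta> ^ n * (s * lam ^ n * x + (1 - s * lam ^ n) * \<mu>) + (1 - \<delta> ^ n) * 0"
      by (rule convex_combination_ge) (use n m1 in auto)
    then show ?thesis by (simp add: L_def algebra_simps)
  qed
  show ?thesis
  proof (intro exI[of _ f] scalar_value.intro)
    fix x :: real assume x: "-1 \<le> x"
    show "0 \<le> f x" using L_ge[OF x] by (simp add: f_def)
    have "\<mu> + s * lam ^ N x * (x - \<mu>) = s * it (N x) x + (1 - s) * \<mu>"
      by (simp add: it_def algebra_simps)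
    also have "\<dots> \<le> 0" using s0 s1 N[of x] \<mu> by (intro add_nonpos_nonpos mult_nonneg_nonpos) auto
    finally show "f x \<le> 1" using \<delta> by (simp add: f_def L_def mult_nonneg_nonpos)
    show "\<exists>c d. f x = c + d * x \<and> (\<forall>y\<ge>-1. f y \<le> c + d * y)"
      by (rule exI[of _ "1 + \<delta> ^ N x * (\<mu> - s * lam ^ N x * \<mu>)"], rule exI[of _ "\<delta> ^ N x * s * lam ^ N x"])
        (use f_le[of _ "N x"] in \<open>auto simp: f_def L_def algebra_simps\<close>)
  next
    fix x :: real assume x: "0 \<le> x"
    show "f x = 1 - \<delta> + \<delta> * f (?xi x)"
    proof (rule antisym)
      show "f x \<le> 1 - \<delta> + \<delta> * f (?xi x)"
        using f_le[of x "Suc (N (?xi x))"] by (simp add: LSuc f_def)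
      \<comment> \<open>The reverse inequality needs an index of the form \<open>Suc n\<close>; if
        \<open>N x = 0\<close>, index 1 does as well, since \<open>0 \<le> x\<close>.\<close>
      have "\<exists>n. L (Suc n) x \<le> f x"
      proof (cases "N x")
        case 0
        have "L (Suc 0) x - L 0 x \<le> 0" unfolding Ldiff using \<delta> x by (simp add: it_def)
        then show ?thesis using 0 by (auto simp: f_def intro!: exI[of _ 0])
      qed (auto simp: f_def)
      then obtain n where n: "L (Suc n) x \<le> f x" ..
      have "\<delta> * f (?xi x) \<le> \<delta> * L n (?xi x)" using f_le \<delta> by (intro mult_left_mono) auto
      then show "1 - \<delta> + \<delta> * f (?xi x) \<le> f x" using n by (simp add: LSuc)
    qed
  next
    fix x :: real assume x: "-1 \<le> x" "x \<le> 0"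
    then show "f x = (1 + x) * f 0 - x * f (-1)" by (simp add: neg l_def algebra_simps)
    have "0 \<le> (1 - \<delta>) * (1 + x)" using x \<delta> by simp
    then show "\<delta> * f (?xi x) \<le> f x" using D[of x] x xi_neg[of x] by (simp add: neg)
  next
    fix x t :: real assume x: "-1 \<le> x" "x \<le> 0" and t: "0 \<le> t"
    let ?u = "?xi x"
    have "?u < 0" using xi_neg x by simp
    moreover from this have "?u / (1 + t) \<le> 0" using t by (simp add: divide_nonpos_pos)
    moreover have "(1 + t) * l (?u / (1 + t)) = l ?u + t * l 0"
      using t by (simp add: l_def field_simps)
    ultimately show "(1 + t) * f (?u / (1 + t)) = f ?u + t * f 0" by (simp add: neg)
  next
    show "f (-1) = \<delta> * f (?xi (-1))" using D[of "-1"] xi_neg[of "-1"] by (simp add: neg)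
    show "f (-1) \<le> f 0" using s0 by (simp add: neg l_def algebra_simps)
  qed (use assms in auto)
qed

lemma scalar_value_exists:
  fixes \<mu> lam \<delta> :: real
  assumes "0 \<le> lam" "lam < 1" "0 \<le> \<delta>" "\<delta> < 1" "-1 \<le> \<mu>"
  shows "\<exists>f. scalar_value \<mu> lam \<delta> f"
  using assms scalar_value_exists_pos scalar_value_exists_neg by (cases "0 \<le> \<mu>") auto

subsection \<open>Reduction to the scalar problem\<close>

lemma phi_trans_matrix:
  "phi (trans_matrix m lam) q = lam *\<^sub>R q + ((1 - lam) * (\<Sum>i\<in>UNIV. q $ i)) *\<^sub>R m"
proof -
  have "(\<Sum>i\<in>UNIV. q $ i * ((1 - lam) * m $ j + (if i = j then lam else 0)))
      = lam * q $ j + (1 - lam) * (\<Sum>i\<in>UNIV. q $ i) * m $ j" for j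
  proof -
    have "(\<Sum>i\<in>UNIV. q $ i * ((1 - lam) * m $ j + (if i = j then lam else 0)))
        = (\<Sum>i\<in>UNIV. (1 - lam) * m $ j * q $ i) + (\<Sum>i\<in>UNIV. if i = j then lam * q $ i else 0)"
      unfolding sum.distrib[symmetric] by (rule sum.cong) (auto simp: algebra_simps)
    then show ?thesis by (simp add: sum_distrib_left sum_distrib_right mult_ac)
  qed
  then show ?thesis
    by (simp add: phi_def trans_matrix_def vector_matrix_mult_def vec_eq_iff)
qed

lemma linear_phi: "linear (phi M)"
  unfolding phi_def by (rule linearI) (simp_all add: vector_matrix_left_distrib scaleR_vector_matrix_assoc)

lemma linear_rpay: "linear (rpay r)"
  by (rule linearI) (simp_all add: rpay_def sum.distrib distrib_right sum_distrib_left mult.assoc)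

lemma rpay_axis: "rpay r (axis i 1) = r i"
  by (simp add: rpay_def axis_def if_distrib[of "\<lambda>u. u * _"] cong: if_cong)

lemma rpay_ge:
  assumes "p \<in> Delta" "\<And>w. c \<le> r w"
  shows "c \<le> rpay r p"
proof -
  have "(\<Sum>w\<in>UNIV. p $ w * c) \<le> rpay r p"
    unfolding rpay_def using assms by (intro sum_mono mult_left_mono) (auto simp: Delta_def)
  then show ?thesis using assms by (simp add: Delta_def flip: sum_distrib_right)
qed

text \<open>The chain keeps its state with probability \<open>lam\<close> and otherwise redraws it
  from \<open>m\<close>. Dividing by \<open>- r C\<close> puts the worst state \<open>C\<close> at
  the scalar belief -1.\<close>

locale renovation =
  scalar_value "rpay r m / - r C" lam \<delta> f
  for r :: "'w::finite \<Rightarrow> real" and m lam \<delta> f C +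
  assumes m: "m \<in> Delta" and rC: "r C < 0" and rmin: "r C \<le> r w"
begin

abbreviation ph :: "real^'w \<Rightarrow> real^'w" where "ph \<equiv> phi (trans_matrix m lam)"

definition x :: "real^'w \<Rightarrow> real" where "x p = rpay r p / - r C"

lemma linear_x: "linear x"
  unfolding x_def by (rule linearI)
    (simp_all add: linear_add[OF linear_rpay] linear_scale[OF linear_rpay] add_divide_distrib diff_divide_distrib)

lemmas x_simps = linear_add[OF linear_x] linear_diff[OF linear_x] linear_scale[OF linear_x]

lemma x_measurable [measurable]: "x \<in> borel_measurable borel"
  unfolding x_def by measurable

lemma x_axis: "x (axis i 1) = r i / - r C"
  by (simp add: x_def rpay_axis)

lemma ph_Delta: "q \<in> Delta \<Longrightarrow> ph q = lam *\<^sub>R q + (1 - lam) *\<^sub>R m"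
  by (simp add: phi_trans_matrix Delta_def)

lemma ph_in_Delta: "q \<in> Delta \<Longrightarrow> ph q \<in> Delta"
  using Delta_convex_comb[of m q lam] Delta_convex_comb[of q m "1 - lam"] lam m by (simp add: ph_Delta)

lemma x_ph: "q \<in> Delta \<Longrightarrow> x (ph q) = lam * x q + (1 - lam) * (rpay r m / - r C)"
  by (simp add: ph_Delta x_simps) (simp add: x_def)

lemma x_ge: "p \<in> Delta \<Longrightarrow> -1 \<le> x p"
  using rpay_ge[OF _ rmin] rC by (simp add: x_def field_simps)

lemma Iset_x: "p \<in> Iset r \<longleftrightarrow> p \<in> Delta \<and> 0 \<le> x p"
  using rC by (auto simp: Iset_def x_def field_simps)

lemma Jset_x: "p \<in> Jset r \<longleftrightarrow> p \<in> Delta \<and> x p < 0"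
  by (auto simp: Jset_def Iset_x)

lemma supported_scalar: "supported (\<lambda>p. f (x p))"
  unfolding supported_def
proof
  fix p :: "real^'w" assume p: "p \<in> Delta"
  obtain c d where cd: "f (x p) = c + d * x p" "\<forall>y\<ge>-1. f y \<le> c + d * y"
    using f_support[OF x_ge[OF p]] by blast
  \<comment> \<open>On \<open>Delta\<close> the coordinates sum to 1, so the constant
    \<open>c\<close> can be made linear.\<close>
  let ?h = "\<lambda>q :: real^'w. c * (\<Sum>i\<in>UNIV. q $ i) + d * x q"
  have "linear ?h"
    by (rule linearI) (simp_all add: sum.distrib x_simps algebra_simps flip: sum_distrib_left)
  moreover have "?h p = f (x p)" using p cd by (simp add: Delta_def)
  moreover have "f (x q) \<le> ?h q" if "q \<in> Delta" for q
    using cd(2) x_ge[OF that] that by (simp add: Delta_def)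
  ultimately show "\<exists>h. linear h \<and> h p = f (x p) \<and> (\<forall>q\<in>Delta. f (x q) \<le> h q)" by blast
qed

lemma scalar_step:
  assumes q: "q \<in> Delta"
  shows "(1 - \<delta>) * indicator (Iset r) q + \<delta> * f (x (ph q)) \<le> f (x q)"
proof (cases "0 \<le> x q")
  case True
  then show ?thesis using q f_pos[OF True] by (simp add: Iset_x x_ph)
next
  case False
  then show ?thesis using q f_discount[of "x q"] x_ge[OF q] by (simp add: Iset_x x_ph)
qed

lemma scalar_stepI: "p \<in> Iset r \<Longrightarrow> f (x p) = 1 - \<delta> + \<delta> * f (x (ph p))"
  using f_pos[of "x p"] by (simp add: Iset_x x_ph)

text \<open>Posteriors in \<open>I\<close> have \<open>x \<ge> 0\<close> and all others
  \<open>x \<ge> -1\<close>; averaging gives \<open>x p \<ge> - (1 - a)\<close>.\<close>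

lemma feasible_split_le:
  assumes "feasible_split r p a qI qJ"
  shows "a \<le> 1 + x p"
proof -
  have s: "0 \<le> a" "a \<le> 1" "qI \<in> Iset r" "qJ \<in> Delta" "p = a *\<^sub>R qI + (1 - a) *\<^sub>R qJ"
    using assms by (auto simp: feasible_split_def)
  have "0 \<le> a * x qI" "0 \<le> (1 - a) * (x qJ + 1)"
    using s x_ge[OF s(4)] by (auto simp: Iset_x)
  then show ?thesis by (simp add: s(5) x_simps algebra_simps)
qed

text \<open>The equality case of the previous bound: both slack terms vanish.\<close>

lemma feasible_split_extremal:
  assumes "feasible_split r p (1 + x p) qI qJ" and "x p < 0"
  shows "x qJ = -1" and "x p = -1 \<or> x qI = 0"
proof -
  let ?a = "1 + x p"
  have s: "0 \<le> ?a" "qI \<in> Iset r" "qJ \<in> Delta" and p: "p = ?a *\<^sub>R qI + (1 - ?a) *\<^sub>R qJ"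
    using assms(1) by (auto simp: feasible_split_def)
  have "0 \<le> ?a * x qI" "0 \<le> - x p * (x qJ + 1)"
    using s x_ge[OF s(3)] assms(2) by (auto simp: Iset_x mult_nonpos_nonneg)
  moreover have "x p = ?a * x qI + (1 - ?a) * x qJ"
    by (subst p) (simp only: x_simps real_scaleR_def)
  ultimately have "?a * x qI = 0" "- x p * (x qJ + 1) = 0"
    by (simp_all add: algebra_simps)
  then show "x qJ = -1" "x p = -1 \<or> x qI = 0" using assms(2) by auto
qed

text \<open>An extremal splitting moves the scalar belief to 0 and -1 (unless \<open>qI\<close> has
  weight 0), and \<open>f\<close> is affine between them.\<close>

lemma scalar_stepJ:
  assumes s: "feasible_split r p (1 + x p) qI qJ" and p: "p \<in> Delta" "x p < 0"
  shows "f (x p) = (1 + x p) * (1 - \<delta> + \<delta> * f (x (ph qI))) + (1 - (1 + x p)) * (\<delta> * f (x (ph qJ)))"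
proof -
  have q: "qI \<in> Iset r" "qJ \<in> Delta" using s by (auto simp: feasible_split_def)
  have I: "(1 + x p) * (1 - \<delta> + \<delta> * f (x (ph qI))) = (1 + x p) * f 0"
    using feasible_split_extremal[OF s p(2)] scalar_stepI[OF q(1)] by auto
  have J: "\<delta> * f (x (ph qJ)) = f (-1)"
    using feasible_split_extremal[OF s p(2)] f_worst q by (simp add: x_ph)
  show ?thesis unfolding I J using f_neg[OF x_ge[OF p(1)]] p by simp
qed

text \<open>When the weight \<open>1 + x p\<close> is attained throughout \<open>J\<close>, a
  constant sequence \<open>V\<close> suffices. This covers case (i) and the tie
  \<open>r B = r C\<close>.\<close>

lemma scalar_optimal:
  assumes p1: "p1 \<in> Delta"
    and ex: "\<And>p. p \<in> Jset r \<Longrightarrow> \<exists>qI qJ. feasible_split r p (1 + x p) qI qJ"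
    and str: "is_strategy (trans_matrix m lam) p1 \<sigma>" and gr: "is_greedy r (trans_matrix m lam) p1 \<sigma>"
  shows "optimal r \<delta> (trans_matrix m lam) p1 \<sigma>"
proof (rule greedy_optimal[where V = "\<lambda>_ p. f (x p)", OF p1 \<delta> ph_in_Delta _ _ supported_scalar _ scalar_step _ _ str gr])
  fix p :: "real^'w" and a qI qJ
  assume p: "p \<in> Jset r" and g: "greedy_split r p a qI qJ"
  then have s: "feasible_split r p a qI qJ" by (simp add: greedy_split_def)
  have "1 + x p \<le> a" using ex[OF p] g by (auto simp: greedy_split_def)
  with feasible_split_le[OF s] have "a = 1 + x p" by simp
  then show "f (x p) \<le> a * (1 - \<delta> + \<delta> * f (x (ph qI))) + (1 - a) * (\<delta> * f (x (ph qJ)))"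
    using scalar_stepJ s p by (simp add: Jset_x)
qed (auto intro: f_nonneg f_le_1 x_ge simp: scalar_stepI)

text \<open>Obtained by solving \<open>p = (1 + x p) qI - x p C\<close> for \<open>qI\<close>;
  \<open>e\<close> is a default for weight 0.\<close>

definition posterior_I :: "real^'w \<Rightarrow> real^'w \<Rightarrow> real^'w" where
  "posterior_I e p = (if 1 + x p = 0 then e else (1 / (1 + x p)) *\<^sub>R (p + x p *\<^sub>R axis C 1))"

lemma posterior_I_measurable [measurable]: "posterior_I e \<in> borel_measurable borel"
  unfolding posterior_I_def by measurable

text \<open>The splitting puts mass \<open>- x p\<close> on \<open>C\<close>, so \<open>p\<close>
  must carry at least that much there.\<close>

lemma feasible_split_worst:
  assumes p: "p \<in> Jset r" and C: "0 \<le> x p + p $ C" and e: "e \<in> Iset r"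
  shows "feasible_split r p (1 + x p) (posterior_I e p) (axis C 1)"
proof -
  have pD: "p \<in> Delta" "x p < 0" using p by (auto simp: Jset_x)
  have ge: "-1 \<le> x p" using x_ge[OF pD(1)] .
  have xC: "x (axis C 1) = -1" using rC by (simp add: x_axis)
  show ?thesis
  proof (cases "x p = -1")
    case True
    have C1: "p $ C = 1" using C True Delta_le_1[OF pD(1), of C] by simp
    have "p $ i = 0" if "i \<noteq> C" for i
    proof -
      have "p $ i + p $ C = (\<Sum>j\<in>{i, C}. p $ j)" using that by simp
      also have "\<dots> \<le> (\<Sum>j\<in>UNIV. p $ j)" by (rule sum_mono2) (use pD in \<open>auto simp: Delta_def\<close>)
      finally show ?thesis using C1 pD by (auto simp: Delta_def intro: antisym)
    qed
    then have "p = axis C 1" using C1 by (auto simp: vec_eq_iff axis_def)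
    then show ?thesis using True e axis_Delta[of C] by (simp add: feasible_split_def posterior_I_def)
  next
    case False
    then have a: "0 < 1 + x p" using ge by simp
    let ?q = "(1 / (1 + x p)) *\<^sub>R (p + x p *\<^sub>R axis C 1)"
    have "0 \<le> (p + x p *\<^sub>R axis C 1) $ i" for i
      using C pD by (cases "i = C") (auto simp: axis_def Delta_def)
    then have "0 \<le> ?q $ i" for i using a by simp
    moreover have "(\<Sum>i\<in>UNIV. ?q $ i) = 1"
    proof -
      have "(\<Sum>i\<in>UNIV. ?q $ i) = (1 / (1 + x p)) * ((\<Sum>i\<in>UNIV. p $ i) + x p * (\<Sum>i\<in>UNIV. (axis C 1 :: real^'w) $ i))"
        by (simp add: sum.distrib sum_distrib_left add_divide_distrib sum_divide_distrib)
      then show ?thesis using pD axis_Delta[of C] a by (simp add: Delta_def)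
    qed
    ultimately have "?q \<in> Delta" by (simp add: Delta_def)
    moreover have "x ?q = 0" using xC by (simp add: x_simps)
    ultimately have "?q \<in> Iset r" by (simp add: Iset_x)
    then show ?thesis using a axis_Delta[of C] pD
      by (simp add: feasible_split_def posterior_I_def)
  qed
qed

lemma greedy_split_worst:
  assumes "p \<in> Jset r" "0 \<le> x p + p $ C" "e \<in> Iset r"
  shows "greedy_split r p (1 + x p) (posterior_I e p) (axis C 1)"
  using feasible_split_worst[OF assms] feasible_split_le by (auto simp: greedy_split_def)

end

subsection \<open>Three states, two of them negative\<close>

locale three_states = renovation r m lam \<delta> f C
  for r :: "'w::finite \<Rightarrow> real" and m lam \<delta> f C +
  fixes A B :: 'w
  assumes distinct: "A \<noteq> B" "A \<noteq> C" "B \<noteq> C" and UNIV_ABC: "UNIV = {A, B, C}"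
    and rA: "0 \<le> r A" and rB: "r B < 0"
begin

lemma all_ABC: "(\<forall>i. P i) \<longleftrightarrow> P A \<and> P B \<and> P C"
  using UNIV_ABC by (metis insertE singletonD UNIV_I)

lemma sum_ABC: "(\<Sum>i\<in>UNIV. g i) = g A + g B + (g C :: real)"
  using distinct by (simp add: UNIV_ABC)

lemma Delta_ABC: "p \<in> Delta \<longleftrightarrow> 0 \<le> p $ A \<and> 0 \<le> p $ B \<and> 0 \<le> p $ C \<and> p $ A + p $ B + p $ C = 1"
  by (auto simp: Delta_def sum_ABC all_ABC)

text \<open>The weight of \<open>A\<close> at the zero of the payoff on the edge
  \<open>AB\<close>.\<close>

definition \<tau> :: real where "\<tau> = r B / (r B - r A)"

text \<open>\<open>Bp\<close> is the point \<open>B\<^sup>+\<close>; \<open>(al p, be p, p $ C)\<close> are the barycentric coordinates of \<open>p\<close> with respect to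
  \<open>B\<^sup>+\<close>, \<open>B\<close>, \<open>C\<close>, and \<open>Q p\<close> is the projection of \<open>p\<close> from \<open>B\<^sup>+\<close> to the edge \<open>BC\<close>.\<close>

definition Bp :: "real^'w" where "Bp = \<tau> *\<^sub>R axis A 1 + (1 - \<tau>) *\<^sub>R axis B 1"

definition al :: "real^'w \<Rightarrow> real" where "al p = p $ A / \<tau>"

definition be :: "real^'w \<Rightarrow> real" where "be p = p $ B + p $ A * r A / r B"

definition Q :: "real^'w \<Rightarrow> real^'w" where "Q p = (1 / (1 - al p)) *\<^sub>R (p - al p *\<^sub>R Bp)"

lemma \<tau>: "0 < \<tau>" "\<tau> \<le> 1"
  using rA rB by (auto simp: \<tau>_def divide_neg_neg field_simps)

lemma Bp_nth: "Bp $ A = \<tau>" "Bp $ B = 1 - \<tau>" "Bp $ C = 0"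
  using distinct by (auto simp: Bp_def axis_def)

lemma linear_al: "linear al"
  unfolding al_def by (rule linearI) (simp_all add: add_divide_distrib)

lemma linear_be: "linear be"
  unfolding be_def by (rule linearI) (simp_all add: algebra_simps add_divide_distrib)

lemmas al_simps = linear_add[OF linear_al] linear_diff[OF linear_al] linear_scale[OF linear_al]
lemmas be_simps = linear_add[OF linear_be] linear_diff[OF linear_be] linear_scale[OF linear_be]

lemma measurable_coords [measurable]:
  "al \<in> borel_measurable borel" "be \<in> borel_measurable borel" "Q \<in> borel_measurable borel"
proof -
  show al [measurable]: "al \<in> borel_measurable borel" unfolding al_def by measurable
  show "be \<in> borel_measurable borel" unfolding be_def by measurable
  show "Q \<in> borel_measurable borel" unfolding Q_def by measurable
qed

lemma tau_ratio: "(1 - \<tau>) / \<tau> = - (r A / r B)"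
  using rA rB by (simp add: \<tau>_def field_simps)

text \<open>The payoff vanishes at \<open>Bp\<close>, so the coordinate \<open>al\<close> does not
  enter.\<close>

lemma x_ABC: "x p = (r B * be p + r C * p $ C) / - r C"
  using rB by (simp add: x_def rpay_def sum_ABC be_def algebra_simps)

lemma Bp_coords: "Bp \<in> Delta" "al Bp = 1" "be Bp = 0" "x Bp = 0"
proof -
  show "Bp \<in> Delta" using \<tau> by (simp add: Delta_ABC Bp_nth)
  show "al Bp = 1" using \<tau> by (simp add: al_def Bp_nth)
  show "be Bp = 0" using rA rB by (simp add: be_def Bp_nth \<tau>_def field_simps)
  then show "x Bp = 0" by (simp add: x_ABC Bp_nth)
qed

lemma Bp_Iset: "Bp \<in> Iset r"
  using Bp_coords by (simp add: Iset_x)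

lemma al_nonneg: "p \<in> Delta \<Longrightarrow> 0 \<le> al p"
  using \<tau> by (simp add: al_def Delta_ABC)

lemma coords_sum: "p \<in> Delta \<Longrightarrow> al p + be p + p $ C = 1"
proof -
  assume p: "p \<in> Delta"
  have "al p + be p = p $ B + p $ A * (1 / \<tau> + r A / r B)"
    by (simp add: al_def be_def algebra_simps)
  also have "1 / \<tau> + r A / r B = 1"
    using tau_ratio \<tau> by (simp add: diff_divide_distrib)
  finally show ?thesis using p by (simp add: Delta_ABC)
qed

lemma al_less_1: "p \<in> Delta \<Longrightarrow> 0 < be p \<Longrightarrow> al p < 1"
  using coords_sum[of p] by (auto simp: Delta_ABC)

lemma x_neg: "p \<in> Delta \<Longrightarrow> 0 < be p \<Longrightarrow> x p < 0"
  unfolding x_ABC using rB rC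
  by (intro divide_neg_pos add_neg_nonpos mult_neg_pos mult_nonpos_nonneg) (auto simp: Delta_ABC)

lemma be_Iset: "p \<in> Iset r \<Longrightarrow> be p \<le> 0"
  using x_neg by (force simp: Iset_x)

text \<open>Subtracting the \<open>Bp\<close> part removes the \<open>A\<close> coordinate, so
  \<open>Q\<close> projects onto the line \<open>BC\<close>.\<close>

lemma residual_nth:
  "(p - al p *\<^sub>R Bp) $ A = 0" "(p - al p *\<^sub>R Bp) $ B = be p" "(p - al p *\<^sub>R Bp) $ C = p $ C"
proof -
  have "p $ A / \<tau> * (1 - \<tau>) = - (p $ A * r A / r B)"
    using tau_ratio by (metis mult_minus_right times_divide_eq_left times_divide_eq_right)
  then show "(p - al p *\<^sub>R Bp) $ B = be p" by (simp add: al_def be_def Bp_nth)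
qed (use \<tau> in \<open>auto simp: al_def Bp_nth\<close>)

lemma Q_coords:
  assumes p: "p \<in> Delta" "0 < be p"
  shows "Q p \<in> Delta" "al (Q p) = 0" "0 < be (Q p)" "p = al p *\<^sub>R Bp + (1 - al p) *\<^sub>R Q p"
    "x p = (1 - al p) * x (Q p)" "x (Q p) < 0" "Q (Q p) = Q p"
proof -
  have a: "0 < 1 - al p" using al_less_1[OF p] by simp
  have nth: "Q p $ A = 0" "Q p $ B = be p / (1 - al p)" "Q p $ C = p $ C / (1 - al p)"
    unfolding Q_def vector_scaleR_component residual_nth by auto
  show D: "Q p \<in> Delta"
    using a p coords_sum[OF p(1)] by (simp add: Delta_ABC nth flip: add_divide_distrib)
  show al0: "al (Q p) = 0" by (simp add: al_def nth)
  show be: "0 < be (Q p)" using a p by (simp add: be_def nth)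
  show split: "p = al p *\<^sub>R Bp + (1 - al p) *\<^sub>R Q p" using a by (simp add: Q_def)
  show "x p = (1 - al p) * x (Q p)"
    by (subst split) (simp add: x_simps Bp_coords)
  show "x (Q p) < 0" by (rule x_neg[OF D be])
  show "Q (Q p) = Q p" using al0 by (simp add: Q_def[of "Q p"])
qed

lemma be_ph: "q \<in> Delta \<Longrightarrow> be (ph q) = lam * be q + (1 - lam) * be m"
  by (simp add: ph_Delta be_simps)

text \<open>\<open>be p \<le> 0\<close> singles out the triangle \<open>A\<close>,
  \<open>Bp\<close>, \<open>C\<close>, where splitting towards \<open>C\<close> is feasible; beyond
  it \<open>p\<close> has too little mass at \<open>C\<close>.\<close>

definition greedy_a :: "real^'w \<Rightarrow> real" where
  "greedy_a p = (if be p \<le> 0 then 1 + x p else al p)"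

text \<open>Since \<open>C\<close> is the worst state, every \<open>qI\<close> in \<open>I\<close>
  has \<open>al qI \<ge> 1\<close>; as \<open>al\<close> is linear and nonnegative on
  \<open>Delta\<close>, \<open>al p \<ge> a\<close>. Equality forces both slack terms to
  vanish.\<close>

lemma feasible_split_le_al:
  assumes "feasible_split r p a qI qJ"
  shows "a \<le> al p" and "a = al p \<Longrightarrow> a * (al qI - 1) = 0 \<and> (1 - a) * al qJ = 0"
proof -
  have s: "0 \<le> a" "a \<le> 1" "qI \<in> Iset r" "qJ \<in> Delta" "p = a *\<^sub>R qI + (1 - a) *\<^sub>R qJ" "qI \<in> Delta"
    using assms by (auto simp: feasible_split_def Iset_def)
  have "0 \<le> r B * be qI + r C * qI $ C"
    using s(3) rC by (simp add: Iset_x x_ABC divide_le_0_iff)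
  moreover have "r C * qI $ C \<le> r B * qI $ C"
    using s(6) rmin[of B] by (intro mult_right_mono) (auto simp: Delta_ABC)
  ultimately have "0 \<le> r B * (be qI + qI $ C)" by (simp add: distrib_left)
  then have "be qI + qI $ C \<le> 0" using rB by (simp add: zero_le_mult_iff)
  then have al: "1 \<le> al qI" using coords_sum[OF s(6)] by simp
  have pos: "0 \<le> a * (al qI - 1)" "0 \<le> (1 - a) * al qJ"
    using s al al_nonneg by auto
  moreover have eq: "al p = a + a * (al qI - 1) + (1 - a) * al qJ"
    by (simp add: s(5) al_simps algebra_simps)
  ultimately show "a \<le> al p" by linarith
  show "a = al p \<Longrightarrow> a * (al qI - 1) = 0 \<and> (1 - a) * al qJ = 0"
    using pos eq by linarith
qed

lemma greedy_split_three:
  assumes p: "p \<in> Jset r"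
  shows "greedy_split r p (greedy_a p)
    (if be p \<le> 0 then posterior_I (axis A 1) p else Bp) (if be p \<le> 0 then axis C 1 else Q p)"
proof (cases "be p \<le> 0")
  case True
  have "axis A 1 \<in> Iset r" using rA rC by (simp add: Iset_x axis_Delta x_axis divide_le_0_iff)
  moreover have "0 \<le> x p + p $ C"
    using True rB rC by (simp add: x_ABC field_simps mult_nonpos_nonpos)
  ultimately show ?thesis using greedy_split_worst[OF p] True by (simp add: greedy_a_def)
next
  case False
  then have p': "p \<in> Delta" "0 < be p" using p by (auto simp: Jset_x)
  have "feasible_split r p (al p) Bp (Q p)"
    unfolding feasible_split_def
    using al_less_1[OF p'] al_nonneg[OF p'(1)] Q_coords(1,4)[OF p'] Bp_Iset by (metis less_imp_le)
  then show ?thesis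
    using False feasible_split_le_al(1) by (auto simp: greedy_split_def greedy_a_def)
qed

lemma greedy_a_eq: "p \<in> Jset r \<Longrightarrow> greedy_split r p a qI qJ \<Longrightarrow> a = greedy_a p"
  using greedy_split_three[of p] by (auto simp: greedy_split_def intro!: antisym)

lemma three_states_exists_greedy:
  assumes "p1 \<in> Delta"
  shows "\<exists>\<sigma>. is_strategy (trans_matrix m lam) p1 \<sigma> \<and> is_greedy r (trans_matrix m lam) p1 \<sigma>"
  by (rule exists_greedy_strategy[OF assms ph_in_Delta _ _ _ greedy_split_three])
    (simp_all add: greedy_a_def)

text \<open>With \<open>r B = r C\<close> the bounds \<open>al p\<close> and \<open>1 + x p\<close>
  coincide, so the scalar bound is attained on both sides of the line through \<open>Bp\<close> and
  \<open>C\<close>.\<close>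

lemma tie_feasible:
  assumes "r B = r C" "p \<in> Jset r"
  shows "\<exists>qI qJ. feasible_split r p (1 + x p) qI qJ"
proof -
  have p: "p \<in> Delta" using assms(2) by (simp add: Jset_x)
  have "x p = - (be p + p $ C)" using rC by (simp add: x_ABC assms(1) field_simps)
  then have "greedy_a p = 1 + x p" using coords_sum[OF p] by (simp add: greedy_a_def)
  then show ?thesis using greedy_split_three[OF assms(2)] unfolding greedy_split_def by metis
qed

end

section \<open>Strictly ordered negative payoffs: value iteration beyond the line through
  \<open>Bp\<close> and \<open>C\<close>\<close>

locale three_states_strict = three_states r m lam \<delta> f C A B
  for r :: "'w::finite \<Rightarrow> real" and m lam \<delta> f C A B +
  assumes strict: "r C < r B" and be_m: "be m \<le> 0"
begin

text \<open>\<open>ph q\<close> is a convex combination of \<open>q\<close> and \<open>m\<close>;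
  this is where the position of \<open>m\<close> enters.\<close>

lemma be_ph_le: "q \<in> Delta \<Longrightarrow> be q \<le> 0 \<Longrightarrow> be (ph q) \<le> 0"
  using lam be_m by (simp add: be_ph add_nonpos_nonpos mult_nonneg_nonpos)

text \<open>For \<open>be p > 0\<close> the greedy splitting yields \<open>Bp\<close>, worth
  \<open>f 0\<close>, or \<open>Q p\<close>, which pays nothing now and moves on to
  \<open>ph (Q p)\<close>.\<close>

primrec V :: "nat \<Rightarrow> real^'w \<Rightarrow> real" where
  "V 0 p = f (x p)"
| "V (Suc k) p = (if be p \<le> 0 then f (x p) else al p * f 0 + (1 - al p) * (\<delta> * V k (ph (Q p))))"

lemma V_region: "be p \<le> 0 \<Longrightarrow> V k p = f (x p)"
  by (cases k) auto

lemma f_le_f0: "-1 \<le> u \<Longrightarrow> u \<le> 0 \<Longrightarrow> f u \<le> f 0"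
  using f_neg[of u] mult_nonpos_nonneg[of u "f 0 - f (-1)"] f_mono by (simp add: algebra_simps)

lemma f_x_ray:
  assumes p: "p \<in> Delta" "0 < be p"
  shows "f (x p) = al p * f 0 + (1 - al p) * f (x (Q p))"
proof -
  have e1: "f (x p) = (1 + x p) * f 0 - x p * f (-1)"
    using f_neg[OF x_ge[OF p(1)]] x_neg[OF p] by simp
  have e2: "f (x (Q p)) = (1 + x (Q p)) * f 0 - x (Q p) * f (-1)"
    using f_neg[OF x_ge[OF Q_coords(1)[OF p]]] Q_coords(6)[OF p] by simp
  show ?thesis unfolding e1 e2 by (simp add: Q_coords(5)[OF p] algebra_simps)
qed

lemma V_ray:
  assumes p: "p \<in> Delta" "0 < be p"
  shows "V k p = al p * f 0 + (1 - al p) * V k (Q p)"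
proof (cases k)
  case 0
  then show ?thesis using f_x_ray[OF p] by simp
next
  case (Suc n)
  then show ?thesis using p Q_coords(2,3,7)[OF p] by simp
qed

text \<open>The upper bound propagates by \<open>f_discount\<close> at \<open>Q p\<close>; it is
  what makes the two pieces of \<open>V k\<close> fit together concavely.\<close>

lemma V_bounds: "p \<in> Delta \<Longrightarrow> 0 \<le> V k p \<and> V k p \<le> f (x p)"
proof (induction k arbitrary: p)
  case 0
  then show ?case using f_nonneg x_ge by simp
next
  case (Suc k)
  show ?case
  proof (cases "be p \<le> 0")
    case True
    then show ?thesis using f_nonneg x_ge[OF Suc.prems] by simp
  next
    case False
    then have p: "p \<in> Delta" "0 < be p" using Suc.prems by auto
    note q = Q_coords[OF p]
    have IH: "0 \<le> V k (ph (Q p))" "V k (ph (Q p)) \<le> f (x (ph (Q p)))"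
      using Suc.IH[OF ph_in_Delta[OF q(1)]] by auto
    have a: "0 \<le> al p" "0 \<le> 1 - al p" using al_nonneg[OF p(1)] al_less_1[OF p] by auto
    have "\<delta> * V k (ph (Q p)) \<le> \<delta> * f (x (ph (Q p)))" using IH \<delta> by (intro mult_left_mono)
    also have "\<dots> \<le> f (x (Q p))" using f_discount[of "x (Q p)"] x_ge[OF q(1)] q(6) by (simp add: x_ph q(1))
    finally have "(1 - al p) * (\<delta> * V k (ph (Q p))) \<le> (1 - al p) * f (x (Q p))"
      using a by (intro mult_left_mono)
    then show ?thesis using False a IH \<delta> f_nonneg[of 0] f_x_ray[OF p] by simp
  qed
qed

lemma V_decreasing: "p \<in> Delta \<Longrightarrow> V (Suc k) p \<le> V k p"
proof (induction k arbitrary: p)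
  case 0
  then show ?case using V_bounds[of p "Suc 0"] by simp
next
  case (Suc k)
  show ?case
  proof (cases "be p \<le> 0")
    case False
    then have p: "p \<in> Delta" "0 < be p" using Suc.prems by auto
    have "V (Suc k) (ph (Q p)) \<le> V k (ph (Q p))"
      using Suc.IH[OF ph_in_Delta[OF Q_coords(1)[OF p]]] .
    then have "(1 - al p) * (\<delta> * V (Suc k) (ph (Q p))) \<le> (1 - al p) * (\<delta> * V k (ph (Q p)))"
      using \<delta> al_less_1[OF p] by (intro mult_left_mono) auto
    then show ?thesis using False by (simp del: V.simps add: V.simps(2)[of "Suc k"] V.simps(2)[of k])
  qed simp
qed

text \<open>If \<open>be p \<le> 0\<close>, a support of \<open>f \<circ> x\<close> works, because
  \<open>V (Suc k)\<close> lies below that function and agrees with it at \<open>p\<close>.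
  Otherwise a support of \<open>V k\<close> at \<open>ph (Q p)\<close> is pulled back to
  \<open>h\<close>, which must then be shown to dominate across the line as well.\<close>

lemma V_supported: "supported (V k)"
proof (induction k)
  case 0
  then show ?case using supported_scalar by simp
next
  case (Suc k)
  show ?case
    unfolding supported_def
  proof
    fix p :: "real^'w" assume p: "p \<in> Delta"
    obtain g where g: "linear g" "g p = f (x p)" "\<And>q. q \<in> Delta \<Longrightarrow> f (x q) \<le> g q"
      using supportedE[OF supported_scalar p] by metis
    show "\<exists>h. linear h \<and> h p = V (Suc k) p \<and> (\<forall>q\<in>Delta. V (Suc k) q \<le> h q)"
    proof (cases "be p \<le> 0")
      case True
      have "V (Suc k) q \<le> g q" if "q \<in> Delta" for q
        using V_bounds[OF that, of "Suc k"] g(3)[OF that] by simp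
      then show ?thesis using g True by (intro exI[of _ g]) auto
    next
      case False
      then have bp: "0 < be p" by simp
      obtain l where l: "linear l" "l (ph (Q p)) = V k (ph (Q p))" "\<And>q. q \<in> Delta \<Longrightarrow> V k q \<le> l q"
        using supportedE[OF Suc ph_in_Delta[OF Q_coords(1)[OF p bp]]] by metis
      \<comment> \<open>For \<open>al y < 1\<close> the argument of \<open>ph\<close> is
        \<open>1 - al y\<close> times \<open>Q y\<close>; keeping the factor inside avoids a
        division and makes \<open>h\<close> linear.\<close>
      define h where "h y = al y * f 0 + \<delta> * l (ph (y - al y *\<^sub>R Bp))" for y
      note lph = linear_add[OF l(1)] linear_diff[OF l(1)] linear_scale[OF l(1)]
        linear_add[OF linear_phi] linear_diff[OF linear_phi] linear_scale[OF linear_phi]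
      have lin: "linear h"
        unfolding h_def by (rule linearI) (simp_all add: al_simps lph algebra_simps)
      have h_Q: "h y = al y * f 0 + (1 - al y) * (\<delta> * l (ph (Q y)))" if "al y < 1" for y
      proof -
        have "y - al y *\<^sub>R Bp = (1 - al y) *\<^sub>R Q y" using that by (simp add: Q_def)
        then show ?thesis by (simp add: h_def lph)
      qed
      have hp: "h p = V (Suc k) p" using h_Q[OF al_less_1[OF p bp]] l(2) False by simp
      have h_pos: "V (Suc k) y \<le> h y" if y: "y \<in> Delta" "0 < be y" for y
      proof -
        have "V k (ph (Q y)) \<le> l (ph (Q y))" using l(3)[OF ph_in_Delta[OF Q_coords(1)[OF y]]] .
        then have "(1 - al y) * (\<delta> * V k (ph (Q y))) \<le> (1 - al y) * (\<delta> * l (ph (Q y)))"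
          using \<delta> al_less_1[OF y] by (intro mult_left_mono) auto
        then show ?thesis using h_Q[OF al_less_1[OF y]] y by simp
      qed
      \<comment> \<open>On the line the residual is a multiple of \<open>C\<close>, and
        \<open>f_worst\<close> gives the one-step equation there.\<close>
      have h_zero: "f (x y) \<le> h y" if y: "y \<in> Delta" "be y = 0" for y
      proof -
        have c: "y $ C = 1 - al y" using coords_sum[OF y(1)] y by simp
        then have x: "x y = - (1 - al y)" using rC by (simp add: x_ABC y(2))
        have "y - al y *\<^sub>R Bp = (1 - al y) *\<^sub>R axis C 1"
          unfolding vec_eq_iff all_ABC residual_nth using distinct y c by (simp add: axis_def)
        then have hy: "h y = al y * f 0 + (1 - al y) * (\<delta> * l (ph (axis C 1)))"
          by (simp add: h_def lph)
        have beC: "be (axis C 1) = 0" using distinct by (simp add: be_def axis_def)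
        have xC: "x (axis C 1) = -1" using rC by (simp add: x_axis)
        have "f (-1) = \<delta> * f (x (ph (axis C 1)))" using f_worst axis_Delta[of C] by (simp add: x_ph xC)
        also have "\<dots> = \<delta> * V k (ph (axis C 1))"
          using V_region[OF be_ph_le[OF axis_Delta[of C]]] beC by simp
        also have "\<dots> \<le> \<delta> * l (ph (axis C 1))"
          using l(3)[OF ph_in_Delta[OF axis_Delta[of C]]] \<delta> by (intro mult_left_mono) auto
        finally have "(1 - al y) * f (-1) \<le> (1 - al y) * (\<delta> * l (ph (axis C 1)))"
          using y c by (intro mult_left_mono) (auto simp: Delta_ABC)
        moreover have "f (x y) = al y * f 0 + (1 - al y) * f (-1)"
        proof -
          have "x y \<le> 0" using x y(1) c by (simp add: Delta_ABC)
          then have "f (x y) = (1 + x y) * f 0 - x y * f (-1)" using f_neg x_ge[OF y(1)] by blast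
          also have "\<dots> = al y * f 0 + (1 - al y) * f (-1)" unfolding x by (simp add: algebra_simps)
          finally show ?thesis .
        qed
        ultimately show ?thesis using hy by simp
      qed
      \<comment> \<open>The segment from \<open>p\<close> to \<open>y\<close> meets the line \<open>B\<^sup>+C\<close>, where \<open>h\<close> dominates the concave function
        \<open>f \<circ> x\<close>; at \<open>p\<close> it does not exceed it.\<close>
      have h_neg: "f (x y) \<le> h y" if y: "y \<in> Delta" "be y < 0" for y
      proof -
        define u where "u = be p / (be p - be y)"
        have u: "0 < u" "u \<le> 1" using bp y by (auto simp: u_def field_simps)
        define z where "z = (1 - u) *\<^sub>R p + u *\<^sub>R y"
        have z: "z \<in> Delta" unfolding z_def using Delta_convex_comb[OF p y(1)] u by simp
        have "be z = be p - u * (be p - be y)" by (simp add: z_def be_simps algebra_simps)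
        then have bz: "be z = 0" using bp y by (simp add: u_def)
        obtain g where g: "linear g" "g z = f (x z)" "\<And>q. q \<in> Delta \<Longrightarrow> f (x q) \<le> g q"
          using supportedE[OF supported_scalar z] by metis
        have lin_z: "k z = (1 - u) * k p + u * k y" if "linear k" for k :: "real^'w \<Rightarrow> real"
          unfolding z_def by (simp add: linear_add[OF that] linear_scale[OF that])
        have "(1 - u) * h p \<le> (1 - u) * g p"
          using u V_bounds[OF p, of "Suc k"] g(3)[OF p] hp by (intro mult_left_mono) auto
        moreover have "g z \<le> h z" using h_zero[OF z bz] g(2) by simp
        ultimately have "u * g y \<le> u * h y" using lin_z[OF g(1)] lin_z[OF lin] by linarith
        then have "g y \<le> h y" using u by simp
        then show ?thesis using g(3)[OF y(1)] by simp
      qed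
      have "V (Suc k) y \<le> h y" if y: "y \<in> Delta" for y
        using h_pos[OF y] h_zero[OF y] h_neg[OF y] V_region[of y "Suc k"] by (metis less_le not_less)
      then show ?thesis using lin hp by blast
    qed
  qed
qed

text \<open>\<open>V k\<close> is affine from \<open>ph q\<close> towards \<open>Bp\<close>, here in
  homogeneous form with weights 1 and \<open>t\<close>. If \<open>be (ph q) \<le> 0\<close> this is
  \<open>f_ray\<close>; otherwise both points have the same projection and \<open>V_ray\<close>
  applies.\<close>

lemma V_shift:
  assumes q: "q \<in> Delta" "x q \<le> 0" and t: "0 \<le> t"
  shows "(1 + t) * V k ((1 / (1 + t)) *\<^sub>R (ph q + t *\<^sub>R Bp)) = V k (ph q) + t * f 0"
proof -
  let ?u = "ph q" and ?z = "(1 / (1 + t)) *\<^sub>R (ph q + t *\<^sub>R Bp)"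
  have u: "?u \<in> Delta" using ph_in_Delta[OF q(1)] .
  have bz: "be ?z = be ?u / (1 + t)" by (simp add: be_simps Bp_coords)
  show ?thesis
  proof (cases "be ?u \<le> 0")
    case True
    then have "be ?z \<le> 0" unfolding bz using t by (intro divide_nonpos_pos) auto
    moreover have "x ?z = x ?u / (1 + t)" by (simp add: x_simps Bp_coords)
    ultimately show ?thesis
      using f_ray[OF x_ge[OF q(1)] q(2) t] True by (simp only: V_region x_ph[OF q(1)])
  next
    case False
    then have bu: "0 < be ?u" by simp
    have bz': "0 < be ?z" unfolding bz using bu t by simp
    have zD: "?z \<in> Delta"
      using Delta_convex_comb[OF u Bp_coords(1), of "t / (1 + t)"] t
      by (simp add: scaleR_add_right field_simps)
    have a: "al ?z = (al ?u + t) / (1 + t)" by (simp add: al_simps Bp_coords add_divide_distrib)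
    then have a1: "1 - al ?z = (1 - al ?u) / (1 + t)" using t by (simp add: field_simps)
    have "?z - al ?z *\<^sub>R Bp = (1 / (1 + t)) *\<^sub>R (?u - al ?u *\<^sub>R Bp)"
      unfolding a by (simp add: algebra_simps add_divide_distrib)
    then have Q: "Q ?z = Q ?u"
      unfolding Q_def[of ?z] a1 using t by (simp add: Q_def)
    have "(1 + t) * V k ?z = (1 + t) * al ?z * f 0 + ((1 + t) * (1 - al ?z)) * V k (Q ?u)"
      unfolding V_ray[OF zD bz'] Q by (simp add: algebra_simps)
    also have "(1 + t) * al ?z = al ?u + t" unfolding a using t by simp
    also have "(1 + t) * (1 - al ?z) = 1 - al ?u" unfolding a1 using t by simp
    also have "(al ?u + t) * f 0 + (1 - al ?u) * V k (Q ?u) = V k ?u + t * f 0"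
      unfolding V_ray[OF u bu] by (simp add: algebra_simps)
    finally show ?thesis .
  qed
qed

text \<open>Below \<open>B\<^sup>+C\<close>, splitting towards \<open>B\<^sup>+\<close> beats waiting: with \<open>q = Q p\<close> and \<open>t = lam \<cdot> al p\<close> one has
  \<open>\<phi>(q) + t B\<^sup>+ = \<phi>(p) + t q\<close>, and \<open>V\<close> is concave but affine along the ray towards \<open>B\<^sup>+\<close>.\<close>

lemma V_step:
  assumes p: "p \<in> Delta"
  shows "(1 - \<delta>) * indicator (Iset r) p + \<delta> * V k (ph p) \<le> V (Suc k) p"
proof (cases "be p \<le> 0")
  case True
  then show ?thesis using scalar_step[OF p] V_region[OF be_ph_le[OF p True]] by simp
next
  case False
  then have bp: "0 < be p" by simp
  note q = Q_coords[OF p bp]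
  let ?q = "Q p"
  define t where "t = lam * al p"
  have a: "0 \<le> al p" "al p \<le> 1" using al_nonneg[OF p] al_less_1[OF p bp] by auto
  have t: "0 \<le> t" using lam a by (simp add: t_def)
  let ?z = "(1 / (1 + t)) *\<^sub>R (ph ?q + t *\<^sub>R Bp)"
  have "ph p = ph ?q + lam *\<^sub>R (p - ?q)" using p q(1) by (simp add: ph_Delta scaleR_diff_right)
  also have "p - ?q = al p *\<^sub>R Bp + (1 - al p) *\<^sub>R ?q - ?q" using q(4) by (rule arg_cong)
  also have "\<dots> = al p *\<^sub>R (Bp - ?q)" by (simp add: algebra_simps)
  finally have php: "ph p + t *\<^sub>R ?q = ph ?q + t *\<^sub>R Bp" by (simp add: t_def scaleR_diff_right)
  have zD: "?z \<in> Delta"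
    using Delta_convex_comb[OF ph_in_Delta[OF q(1)] Bp_coords(1), of "t / (1 + t)"] t
    by (simp add: scaleR_add_right field_simps)
  obtain h where h: "linear h" "h ?z = V k ?z" "\<And>y. y \<in> Delta \<Longrightarrow> V k y \<le> h y"
    using supportedE[OF V_supported zD] by metis
  have "(1 + t) * h ?z = h (ph p + t *\<^sub>R ?q)"
    unfolding php using t by (simp add: linear_scale[OF h(1)])
  also have "\<dots> = h (ph p) + t * h ?q" by (simp add: linear_add[OF h(1)] linear_scale[OF h(1)])
  also have "\<dots> \<ge> V k (ph p) + t * V k ?q"
    using h(3)[OF ph_in_Delta[OF p]] h(3)[OF q(1)] t by (intro add_mono mult_left_mono) auto
  finally have "V k (ph p) + t * V k ?q \<le> V k (ph ?q) + t * f 0"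
    using V_shift[OF q(1) less_imp_le[OF q(6)] t, of k] h(2) by simp
  then have "\<delta> * (V k (ph p) + t * V k ?q) \<le> \<delta> * (V k (ph ?q) + t * f 0)"
    using \<delta> by (intro mult_left_mono)
  then have "\<delta> * V k (ph p) \<le> \<delta> * V k (ph ?q) + \<delta> * t * (f 0 - V k ?q)"
    by (simp add: algebra_simps)
  also have "\<dots> = V (Suc k) ?q + \<delta> * t * (f 0 - V k ?q)" using q(2,3,7) by simp
  also have "\<dots> \<le> V (Suc k) ?q + \<delta> * t * (f 0 - V (Suc k) ?q)"
    using V_decreasing[OF q(1), of k] \<delta> t by (intro add_left_mono mult_left_mono) auto
  \<comment> \<open>As \<open>\<delta> * lam \<le> 1\<close>, the coefficient can be raised to
    \<open>al p\<close>, the weight of \<open>Bp\<close> in \<open>V_ray\<close>.\<close>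
  also have "\<dots> \<le> V (Suc k) ?q + al p * (f 0 - V (Suc k) ?q)"
  proof (intro add_left_mono mult_right_mono)
    have "\<delta> * lam \<le> 1" using \<delta> lam by (intro mult_le_one) auto
    then show "\<delta> * t \<le> al p" unfolding t_def using mult_right_mono[of "\<delta> * lam" 1 "al p"] a by (simp add: mult.assoc)
    have "V (Suc k) ?q \<le> f (x ?q)" using V_bounds[OF q(1)] by blast
    also have "\<dots> \<le> f 0" using f_le_f0 x_ge[OF q(1)] q(6) by simp
    finally show "0 \<le> f 0 - V (Suc k) ?q" by simp
  qed
  also have "\<dots> = V (Suc k) p" unfolding V_ray[OF p bp, of "Suc k"] by (simp add: algebra_simps)
  finally show ?thesis using x_neg[OF p bp] by (simp add: Iset_x)
qed

text \<open>The bound is needed for an arbitrary maximiser. For \<open>be p \<le> 0\<close>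
  maximality keeps \<open>qJ\<close> in the invariant region; otherwise it forces
  \<open>qJ = Q p\<close>, and \<open>qI = Bp\<close> unless its weight is 0.\<close>

lemma V_stepJ:
  assumes p: "p \<in> Jset r" and g: "greedy_split r p a qI qJ"
  shows "V (Suc k) p \<le> a * (1 - \<delta> + \<delta> * V k (ph qI)) + (1 - a) * (\<delta> * V k (ph qJ))"
proof -
  have s: "feasible_split r p a qI qJ" using g by (simp add: greedy_split_def)
  then have q: "qI \<in> Iset r" "qI \<in> Delta" "qJ \<in> Delta" and split: "p = a *\<^sub>R qI + (1 - a) *\<^sub>R qJ"
    by (auto simp: feasible_split_def Iset_def)
  have pD: "p \<in> Delta" "x p < 0" using p by (auto simp: Jset_x)
  have bI: "be (ph qI) \<le> 0" using be_ph_le[OF q(2) be_Iset[OF q(1)]] .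
  show ?thesis
  proof (cases "be p \<le> 0")
    case True
    then have a: "a = 1 + x p" using greedy_a_eq[OF p g] by (simp add: greedy_a_def)
    have "x qJ = -1" using feasible_split_extremal(1)[OF _ pD(2)] s a by blast
    then have "r B * be qJ + r C * qJ $ C = r C" using rC by (simp add: x_ABC field_simps)
    moreover have "qJ $ C = 1 - al qJ - be qJ" using coords_sum[OF q(3)] by simp
    ultimately have "(r B - r C) * be qJ = r C * al qJ" by (simp add: algebra_simps)
    also have "\<dots> \<le> 0" using rC al_nonneg[OF q(3)] by (simp add: mult_nonpos_nonneg)
    finally have "be qJ \<le> 0" using strict by (simp add: mult_le_0_iff)
    then have "be (ph qJ) \<le> 0" using be_ph_le q by blast
    then show ?thesis
      using scalar_stepJ[OF _ pD] s True by (simp add: a V_region bI)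
  next
    case False
    then have bp: "0 < be p" by simp
    have a: "a = al p" using greedy_a_eq[OF p g] False by (simp add: greedy_a_def)
    have e: "a * (al qI - 1) = 0" "(1 - a) * al qJ = 0"
      using feasible_split_le_al(2)[OF s a] by auto
    have a1: "a < 1" using al_less_1[OF pD(1) bp] a by simp
    have I: "qI = Bp" if "a \<noteq> 0"
    proof -
      have al: "al qI = 1" using e that by simp
      have "0 \<le> r B * be qI + r C * qI $ C"
        using q(1) rC by (simp add: Iset_x x_ABC divide_le_0_iff)
      moreover have be: "be qI = - qI $ C" using coords_sum[OF q(2)] al by simp
      ultimately have "0 \<le> (r C - r B) * qI $ C" by (simp add: algebra_simps)
      then have "qI $ C = 0" using strict q(2) by (simp add: zero_le_mult_iff Delta_ABC)
      then have "(qI - al qI *\<^sub>R Bp) = 0"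
        unfolding vec_eq_iff all_ABC residual_nth using be by simp
      then show ?thesis using al by simp
    qed
    have "a *\<^sub>R qI = a *\<^sub>R Bp" using I by (cases "a = 0") auto
    then have "p - a *\<^sub>R Bp = (1 - a) *\<^sub>R qJ" using split by simp
    then have Q: "Q p = qJ" unfolding Q_def a[symmetric] using a1 by simp
    have aI: "a * (1 - \<delta> + \<delta> * V k (ph qI)) = a * f 0"
    proof (cases "a = 0")
      case False
      then show ?thesis
        using scalar_stepI[OF q(1)] V_region[OF bI] I Bp_coords(4) by simp
    qed simp
    show ?thesis unfolding aI using False Q a by simp
  qed
qed

lemma strict_optimal:
  assumes p1: "p1 \<in> Delta"
    and str: "is_strategy (trans_matrix m lam) p1 \<sigma>" and gr: "is_greedy r (trans_matrix m lam) p1 \<sigma>"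
  shows "optimal r \<delta> (trans_matrix m lam) p1 \<sigma>"
proof (rule greedy_optimal[where V = V, OF p1 \<delta> ph_in_Delta _ _ V_supported V_decreasing V_step _ V_stepJ str gr])
  show "V (Suc k) p \<le> 1 - \<delta> + \<delta> * V k (ph p)" if p: "p \<in> Iset r" for k p
    using scalar_stepI[OF p] V_region be_ph_le be_Iset[OF p] p by (simp add: Iset_x)
qed (use V_bounds in \<open>auto intro: f_le_1 x_ge\<close>)

end

section \<open>The position of \<open>m\<close> and the case distinction\<close>

lemma F_point_Fset:
  assumes "0 \<le> r A" "r B < 0"
  shows "F_point r (axis A 1) (axis B 1) \<in> Fset r"
proof -
  let ?z = "\<lambda>u. (1 - u) *\<^sub>R axis A 1 + u *\<^sub>R axis B 1"
  have rz: "rpay r (?z u) = r A - u * (r A - r B)" for u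
    by (simp add: linear_add[OF linear_rpay] linear_scale[OF linear_rpay] rpay_axis) (simp add: algebra_simps)
  have d: "0 < r A - r B" using assms by simp
  have z: "?z u \<in> closed_segment (axis A 1) (axis B 1) \<and> ?z u \<in> Delta" if "0 \<le> u" "u \<le> 1" for u
    using that Delta_convex_comb[OF axis_Delta axis_Delta] by (auto simp: closed_segment_def)
  define u where "u = r A / (r A - r B)"
  have "rpay r (?z u) = 0" unfolding rz using d by (simp add: u_def)
  then have u: "0 \<le> u" "u \<le> 1" "rpay r (?z u) = 0" using assms d by (auto simp: u_def)
  \<comment> \<open>\<open>THE\<close> requires uniqueness, which holds because the payoff is
    strictly decreasing along the segment.\<close>
  have "\<exists>!y. y \<in> closed_segment (axis A 1) (axis B 1) \<and> y \<in> Fset r"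
  proof (rule ex1I[of _ "?z u"])
    show "?z u \<in> closed_segment (axis A 1) (axis B 1) \<and> ?z u \<in> Fset r" using z u by (simp add: Fset_def)
    fix y assume y: "y \<in> closed_segment (axis A 1) (axis B 1) \<and> y \<in> Fset r"
    then obtain t where t: "y = ?z t" by (auto simp: closed_segment_def)
    then have "t * (r A - r B) = u * (r A - r B)" using y u(3) unfolding Fset_def rz by (simp add: rz)
    then have "t = u" using d by simp
    then show "y = ?z u" using t by simp
  qed
  from theI'[OF this] show ?thesis unfolding F_point_def by blast
qed

text \<open>\<open>be \<le> 0\<close> is a half-space containing the three vertices: the first two
  have payoff 0 and so lie in \<open>I\<close>, and \<open>be\<close> vanishes at
  \<open>C\<close>.\<close>

lemma (in three_states) be_triangle:
  assumes "p \<in> convex hull {F_point r (axis A 1) (axis C 1), F_point r (axis A 1) (axis B 1), axis C 1}"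
  shows "be p \<le> 0"
proof -
  have F: "be q \<le> 0" if "q \<in> Fset r" for q using that be_Iset by (simp add: Fset_def Iset_def)
  have "convex {q. be q \<le> 0}"
    by (rule convexI) (simp add: be_simps add_nonpos_nonpos mult_nonneg_nonpos)
  moreover have "be (axis C 1) = 0" using distinct by (simp add: be_def axis_def)
  ultimately have "convex hull {F_point r (axis A 1) (axis C 1), F_point r (axis A 1) (axis B 1), axis C 1}
      \<subseteq> {q. be q \<le> 0}"
    using F F_point_Fset[of r A C] F_point_Fset[of r A B] rA rB rC by (intro hull_minimal) auto
  then show ?thesis using assms by blast
qed

theorem theorem4:
  fixes m :: "real^'w::finite" and lam \<delta> :: real and r :: "'w \<Rightarrow> real" and p1 :: "real^'w"
  assumes "CARD('w) = 3"
    and "m \<in> Delta" and "0 \<le> lam" and "lam < 1"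
    and "irreducible_chain (trans_matrix m lam)"
    and "0 \<le> \<delta>" and "\<delta> < 1"
    and "card (Omega_minus r) = 1 \<or>
         (card (Omega_minus r) = 2 \<and>
          (\<exists>A B C. Omega_plus r = {A} \<and> Omega_minus r = {B, C} \<and> B \<noteq> C \<and> r C \<le> r B \<and>
             (m \<in> Iset r \<or>
              m \<in> convex hull {F_point r (axis A 1) (axis C 1), F_point r (axis A 1) (axis B 1), axis C 1})))"
    and "p1 \<in> Delta"
  shows "(\<exists>\<sigma>. is_strategy (trans_matrix m lam) p1 \<sigma> \<and> is_greedy r (trans_matrix m lam) p1 \<sigma>)
       \<and> (\<forall>\<sigma>. is_strategy (trans_matrix m lam) p1 \<sigma> \<and> is_greedy r (trans_matrix m lam) p1 \<sigma>
              \<longrightarrow> optimal r \<delta> (trans_matrix m lam) p1 \<sigma>)"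
proof -
  have renov: "\<exists>f. renovation r m lam \<delta> f C" if "r C < 0" "\<And>w. r C \<le> r w" for C
  proof -
    have "-1 \<le> rpay r m / - r C"
      using rpay_ge[of m "r C" r] that assms(2) by (simp add: field_simps)
    then obtain f where "scalar_value (rpay r m / - r C) lam \<delta> f"
      using scalar_value_exists assms(3,4,6,7) by blast
    then have "renovation r m lam \<delta> f C"
      by (rule renovation.intro, intro renovation_axioms.intro assms(2) that)
    then show ?thesis by blast
  qed
  from assms(8) show ?thesis
  proof
    assume "card (Omega_minus r) = 1"
    then obtain C where C: "Omega_minus r = {C}" by (rule card_1_singletonE)
    have pos: "0 \<le> r w" if "w \<noteq> C" for w
    proof -
      have "w \<notin> Omega_minus r" using C that by simp
      then show ?thesis by (simp add: Omega_minus_def)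
    qed
    have "C \<in> Omega_minus r" using C by simp
    then have rC: "r C < 0" by (simp add: Omega_minus_def)
    have "r C \<le> r w" for w using pos[of w] rC by (cases "w = C") auto
    then obtain f where "renovation r m lam \<delta> f C" using renov rC by blast
    then interpret renovation r m lam \<delta> f C .
    have "UNIV \<noteq> {C}"
    proof
      assume "UNIV = {C}"
      then have "CARD('w) = card {C}" by (rule arg_cong)
      then show False using assms(1) by simp
    qed
    then obtain A where "A \<noteq> C" by blast
    then have A: "axis A 1 \<in> Iset r" using pos[of A] by (simp add: Iset_def axis_Delta rpay_axis)
    \<comment> \<open>Only \<open>C\<close> contributes negatively to the payoff, so splitting
      towards \<open>C\<close> is feasible throughout \<open>J\<close>.\<close>
    have low: "0 \<le> x p + p $ C" if "p \<in> Jset r" for p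
    proof -
      have "(\<Sum>w\<in>UNIV. if w = C then p $ C * r C else 0) \<le> rpay r p"
        unfolding rpay_def
        by (rule sum_mono) (use that pos in \<open>auto simp: Jset_def Delta_def\<close>)
      then show ?thesis using rC by (simp add: x_def field_simps)
    qed
    have "\<exists>\<sigma>. is_strategy (trans_matrix m lam) p1 \<sigma> \<and> is_greedy r (trans_matrix m lam) p1 \<sigma>"
      by (rule exists_greedy_strategy[OF assms(9) ph_in_Delta _ _ _ greedy_split_worst[OF _ low A]]) simp_all
    then show ?thesis
      using scalar_optimal[OF assms(9)] feasible_split_worst[OF _ low A] by blast
  next
    assume "card (Omega_minus r) = 2 \<and>
      (\<exists>A B C. Omega_plus r = {A} \<and> Omega_minus r = {B, C} \<and> B \<noteq> C \<and> r C \<le> r B \<and>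
        (m \<in> Iset r \<or>
         m \<in> convex hull {F_point r (axis A 1) (axis C 1), F_point r (axis A 1) (axis B 1), axis C 1}))"
    then obtain A B C
      where P: "Omega_plus r = {A}" and M: "Omega_minus r = {B, C}" and ne: "B \<noteq> C" and le: "r C \<le> r B"
        and mm: "m \<in> Iset r \<or>
          m \<in> convex hull {F_point r (axis A 1) (axis C 1), F_point r (axis A 1) (axis B 1), axis C 1}"
      by metis
    have "Omega_plus r \<union> Omega_minus r = UNIV" by (auto simp: Omega_plus_def Omega_minus_def)
    then have U: "UNIV = {A, B, C}" unfolding P M by blast
    have r: "0 \<le> r A" "r B < 0" "r C < 0"
      using P M unfolding Omega_plus_def Omega_minus_def by blast+
    have "r C \<le> r w" for w
    proof -
      have "w \<in> {A, B, C}" using U by blast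
      then show ?thesis using r le by auto
    qed
    then obtain f where "renovation r m lam \<delta> f C" using renov r by blast
    then interpret renovation r m lam \<delta> f C .
    interpret three_states r m lam \<delta> f C A B
    proof unfold_locales
      show "A \<noteq> B" "A \<noteq> C" using r by auto
    qed (fact U ne r)+
    have opt: "optimal r \<delta> (trans_matrix m lam) p1 \<sigma>"
      if "is_strategy (trans_matrix m lam) p1 \<sigma>" "is_greedy r (trans_matrix m lam) p1 \<sigma>" for \<sigma>
    \<comment> \<open>At a tie the scalar bound is attained on all of \<open>J\<close>; otherwise
      the iteration \<open>V\<close> takes over.\<close>
    proof (cases "r B = r C")
      case True
      then show ?thesis using scalar_optimal[OF assms(9)] tie_feasible that by blast
    next
      case False
      have "be m \<le> 0" using mm be_Iset be_triangle by blast
      then interpret three_states_strict r m lam \<delta> f C A B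
        by unfold_locales (use False le in auto)
      show ?thesis using strict_optimal[OF assms(9) that] .
    qed
    show ?thesis using three_states_exists_greedy[OF assms(9)] opt by blast
  qed
qed

end
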